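(* Let $A\in C^\infty(\mathbb T;\mathbb R)$, and for $u\in\mathcal D'(\mathbb T^2)$ let $(\Psi_{\pm A}u)(t,x)=u(t,x\mp A(t))$, understood as pullback by the corresponding smooth diffeomorphism of $\mathbb T^2$. For every $s\in\mathbb R$, the operators $\Psi_A$ and $\Psi_{-A}$ are mutually inverse bounded automorphisms of $H^s(\mathbb T^2)$.
   Context: $\mathbb T=\mathbb R/2\pi\mathbb Z$, with variables $(t,x)\in\mathbb T^2$ and dual frequencies $(\tau,\xi)\in\mathbb Z^2$. $\mathcal D'(\mathbb T^2)$ is the space of distributions on $\mathbb T^2$. Fourier coefficients are $\widehat f(\tau,\xi)=\frac1{(2\pi)^2}\int_{\mathbb T^2}f(t,x)e^{-i(t\tau+x\xi)}\,dt\,dx$ (by duality for distributions). $\langle w\rangle=(1+|w|^2)^{1/2}$. For $s\in\mathbb R$, $H^s(\mathbb T^2)$ is the isotropic Sobolev space of $f\in\mathcal D'(\mathbb T^2)$ with $\|f\|_{H^s(\mathbb T^2)}^2=\sum_{(\tau,\xi)\in\mathbb Z^2}\langle(\tau,\xi)\rangle^{2s}|\widehat f(\tau,\xi)|^2<\infty$. *)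

theory Defs
  imports "HOL-Analysis.Analysis"
begin

text \<open>
  Functions on the torus \<open>\<real>/2\<pi>\<int>\<close> (resp. its square) are represented by their \<open>2\<pi>\<close>-periodic lifts
  to \<open>\<real>\<close> (resp. \<open>\<real> \<times> \<real>\<close>), points of the latter being written \<open>(t, x)\<close>.
\<close>

definition dir_deriv ::
  "'a::euclidean_space \<Rightarrow> ('a \<Rightarrow> 'b::real_normed_vector) \<Rightarrow> 'a \<Rightarrow> 'b" where
  "dir_deriv v f = (\<lambda>z. frechet_derivative f (at z) v)"

primrec C_k :: "nat \<Rightarrow> ('a::euclidean_space \<Rightarrow> 'b::real_normed_vector) \<Rightarrow> bool" where
  "C_k 0 f \<longleftrightarrow> continuous_on UNIV f"
| "C_k (Suc k) f \<longleftrightarrow> (\<forall>z. f differentiable (at z)) \<and> (\<forall>v. C_k k (dir_deriv v f))"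

definition C_infinity :: "('a::euclidean_space \<Rightarrow> 'b::real_normed_vector) \<Rightarrow> bool" where
  "C_infinity f \<longleftrightarrow> (\<forall>k. C_k k f)"

definition smooth_circle_fun :: "(real \<Rightarrow> real) \<Rightarrow> bool" where
  "smooth_circle_fun A \<longleftrightarrow> C_infinity A \<and> (\<forall>t. A (t + 2 * pi) = A t)"

definition test_funs :: "(real \<times> real \<Rightarrow> complex) set" where
  "test_funs = {\<phi>. C_infinity \<phi> \<and>
     (\<forall>t x. \<phi> (t + 2 * pi, x) = \<phi> (t, x)) \<and> (\<forall>t x. \<phi> (t, x + 2 * pi) = \<phi> (t, x))}"

definition partial_deriv ::
  "nat \<Rightarrow> nat \<Rightarrow> (real \<times> real \<Rightarrow> complex) \<Rightarrow> real \<times> real \<Rightarrow> complex" where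
  "partial_deriv a b \<phi> = (dir_deriv (1, 0) ^^ a) ((dir_deriv (0, 1) ^^ b) \<phi>)"

definition test_seminorm :: "nat \<Rightarrow> (real \<times> real \<Rightarrow> complex) \<Rightarrow> real" where
  "test_seminorm N \<phi> = (\<Sum>(a, b)\<in>{(a, b). a + b \<le> N}. SUP z. cmod (partial_deriv a b \<phi> z))"

text \<open>
  Distributions are the linear functionals on the test functions that are continuous for the
  topology defined by the seminorms above.  A functional is normalised to vanish outside the set of
  test functions, so that equality of distributions is equality in HOL and the vector space
  operations are pointwise.  A function \<open>f\<close> on the torus corresponds to the functional
  \<open>\<phi> \<mapsto> \<integral> f \<phi> dt dx\<close> (bilinear pairing, integration over a period cell, no normalising factor).
\<close>

type_synonym functional = "(real \<times> real \<Rightarrow> complex) \<Rightarrow> complex"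

definition distributions :: "functional set" where
  "distributions = {u.
     (\<forall>\<phi>. \<phi> \<notin> test_funs \<longrightarrow> u \<phi> = 0) \<and>
     (\<forall>\<phi>\<in>test_funs. \<forall>\<psi>\<in>test_funs. u (\<lambda>z. \<phi> z + \<psi> z) = u \<phi> + u \<psi>) \<and>
     (\<forall>c. \<forall>\<phi>\<in>test_funs. u (\<lambda>z. c * \<phi> z) = c * u \<phi>) \<and>
     (\<exists>C N. \<forall>\<phi>\<in>test_funs. cmod (u \<phi>) \<le> C * test_seminorm N \<phi>)}"

definition fourier_coeff :: "functional \<Rightarrow> int \<times> int \<Rightarrow> complex" where
  "fourier_coeff u = (\<lambda>(\<tau>, \<xi>).
     u (\<lambda>(t, x). exp (- \<i> * complex_of_real (t * of_int \<tau> + x * of_int \<xi>)))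
       / complex_of_real ((2 * pi)\<^sup>2))"

definition japanese_bracket :: "real \<times> real \<Rightarrow> real" where
  "japanese_bracket w = sqrt (1 + (norm w)\<^sup>2)"

definition sobolev_term :: "real \<Rightarrow> functional \<Rightarrow> int \<times> int \<Rightarrow> real" where
  "sobolev_term s u = (\<lambda>(\<tau>, \<xi>).
     japanese_bracket (of_int \<tau>, of_int \<xi>) powr (2 * s) * (cmod (fourier_coeff u (\<tau>, \<xi>)))\<^sup>2)"

definition sobolev :: "real \<Rightarrow> functional set" where
  "sobolev s = {u \<in> distributions. sobolev_term s u summable_on UNIV}"

definition sobolev_norm :: "real \<Rightarrow> functional \<Rightarrow> real" where
  "sobolev_norm s u = sqrt (infsum (sobolev_term s u) UNIV)"

definition jacobian_det :: "(real \<times> real \<Rightarrow> real \<times> real) \<Rightarrow> real \<times> real \<Rightarrow> real" where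
  "jacobian_det F z =
     fst (dir_deriv (1, 0) F z) * snd (dir_deriv (0, 1) F z)
     - fst (dir_deriv (0, 1) F z) * snd (dir_deriv (1, 0) F z)"

text \<open>
  Pullback of a distribution by (the lift of) a diffeomorphism \<open>F\<close> of the torus: the extension of
  \<open>f \<mapsto> f \<circ> F\<close> dictated by the change of variables
  \<open>\<integral> f (F z) \<phi> z dz = \<integral> f w \<phi> (inv F w) \<bar>det D(inv F)(w)\<bar> dw\<close>.
\<close>

definition pullback :: "(real \<times> real \<Rightarrow> real \<times> real) \<Rightarrow> functional \<Rightarrow> functional" where
  "pullback F u = (\<lambda>\<phi>. if \<phi> \<in> test_funs
     then u (\<lambda>w. complex_of_real \<bar>jacobian_det (inv F) w\<bar> * \<phi> (inv F w)) else 0)"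

definition Psi :: "(real \<Rightarrow> real) \<Rightarrow> functional \<Rightarrow> functional" where
  "Psi A = pullback (\<lambda>(t, x). (t, x - A t))"

definition bounded_operator_sobolev :: "real \<Rightarrow> (functional \<Rightarrow> functional) \<Rightarrow> bool" where
  "bounded_operator_sobolev s T \<longleftrightarrow>
     T \<in> sobolev s \<rightarrow> sobolev s \<and>
     (\<forall>u\<in>sobolev s. \<forall>v\<in>sobolev s. T (\<lambda>\<phi>. u \<phi> + v \<phi>) = (\<lambda>\<phi>. T u \<phi> + T v \<phi>)) \<and>
     (\<forall>c. \<forall>u\<in>sobolev s. T (\<lambda>\<phi>. c * u \<phi>) = (\<lambda>\<phi>. c * T u \<phi>)) \<and>
     (\<exists>C. \<forall>u\<in>sobolev s. sobolev_norm s (T u) \<le> C * sobolev_norm s u)"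

definition bounded_automorphism_sobolev :: "real \<Rightarrow> (functional \<Rightarrow> functional) \<Rightarrow> bool" where
  "bounded_automorphism_sobolev s T \<longleftrightarrow>
     bounded_operator_sobolev s T \<and> bij_betw T (sobolev s) (sobolev s) \<and>
     bounded_operator_sobolev s (inv_into (sobolev s) T)"

end

theory Submission
  imports Defs
begin

text \<open>
  On the Fourier side the operator acts separately for each \<open>\<xi>\<close>, by the Toeplitz matrix with entries
  \<open>a\<^sub>\<xi> (\<sigma> - \<tau>)\<close>, where \<open>a\<^sub>\<xi>\<close> are the Fourier coefficients of \<open>exp (- \<i> \<xi> A)\<close>.  So the claim is a bound for
  these matrices on \<open>\<ell>\<^sup>2\<close> with weight \<open>(1 + \<tau>\<^sup>2 + \<xi>\<^sup>2) powr s\<close>, uniform in \<open>\<xi>\<close>.  For integers \<open>s \<ge> 0\<close> it follows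
  by induction from Bessel's inequality and the commutator with \<open>- \<i> d/dt\<close>, whose factor \<open>\<xi>\<close> the weight
  absorbs; for \<open>s < 0\<close> by duality, since the adjoint matrix belongs to \<open>- A\<close>; and for real \<open>s\<close> by
  interpolation.  The matrix formula holds for every distribution because Fourier series of smooth
  functions of \<open>t\<close> converge with all derivatives.
\<close>

section \<open>Weighted bounds for infinite matrices\<close>

text \<open>The weight has to be isotropic. For nonconstant \<open>A\<close> the phase moves mass in
  \<tau> over distances comparable to \<xi>, so for nonzero \<open>s\<close> a weight in \<tau>
  alone admits no bound uniform in \<xi>. The \<open>\<xi>^2\<close> in the weight pays for this,
  and a constant independent of \<xi> is what lets the separate matrices be summed over \<xi>.

  \<open>mat_bound\<close> speaks of finite vectors and finitely many rows only. The Fourier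
  coefficients of a distribution may grow, and the infinite matrix product is known to converge only
  along symmetric partial sums, by continuity of the distribution on test functions. Finite
  estimates avoid the question of absolute convergence and survive this limit.

  The matrix entries do not depend on the exponent. A common constant for the exponents
  \<open>N\<close> and \<open>- N\<close>, with \<open>N \<ge> \<bar>s\<bar> + 1\<close>, therefore
  gives every real exponent \<open>s\<close> by the elementary real interpolation method for
  weighted spaces.\<close>

definition mat_bound :: "('i \<Rightarrow> real) \<Rightarrow> ('i \<Rightarrow> 'i \<Rightarrow> complex) \<Rightarrow> real \<Rightarrow> bool" where
  "mat_bound w K C \<longleftrightarrow> (\<forall>E F v. finite E \<longrightarrow> finite F \<longrightarrow>
     (\<Sum>i\<in>F. w i * (cmod (\<Sum>j\<in>E. K i j * v j))\<^sup>2) \<le> C * (\<Sum>j\<in>E. w j * (cmod (v j))\<^sup>2))"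

lemma mat_boundD:
  assumes "mat_bound w K C" "finite E" "finite F"
  shows "(\<Sum>i\<in>F. w i * (cmod (\<Sum>j\<in>E. K i j * v j))\<^sup>2) \<le> C * (\<Sum>j\<in>E. w j * (cmod (v j))\<^sup>2)"
  using assms unfolding mat_bound_def by blast

text \<open>Cauchy-Schwarz with \<open>sqrt (w i)\<close> moved from one factor to the other: the
  weights \<open>w\<close> and \<open>1 / w\<close> are dual.\<close>

lemma cmod_sum_mult_le:
  fixes x y :: "'i \<Rightarrow> complex"
  assumes w: "\<And>i. w i > 0"
  shows "(cmod (\<Sum>i\<in>E. x i * y i))\<^sup>2 \<le> (\<Sum>i\<in>E. (cmod (x i))\<^sup>2 / w i) * (\<Sum>i\<in>E. w i * (cmod (y i))\<^sup>2)"
proof -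
  have pt: "cmod (x i * y i) = (cmod (x i) / sqrt (w i)) * (sqrt (w i) * cmod (y i))" for i
    using w[of i] by (simp add: norm_mult)
  have "(cmod (\<Sum>i\<in>E. x i * y i))\<^sup>2 \<le> (\<Sum>i\<in>E. cmod (x i * y i))\<^sup>2"
    by (intro power_mono norm_sum) auto
  also have "\<dots> = (\<Sum>i\<in>E. (cmod (x i) / sqrt (w i)) * (sqrt (w i) * cmod (y i)))\<^sup>2"
    by (simp only: pt)
  also have "\<dots> \<le> (\<Sum>i\<in>E. (cmod (x i) / sqrt (w i))\<^sup>2) * (\<Sum>i\<in>E. (sqrt (w i) * cmod (y i))\<^sup>2)"
    by (rule Cauchy_Schwarz_ineq_sum)
  also have "\<dots> = (\<Sum>i\<in>E. (cmod (x i))\<^sup>2 / w i) * (\<Sum>i\<in>E. w i * (cmod (y i))\<^sup>2)"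
    using w by (simp add: power_mult_distrib power_divide less_imp_le)
  finally show ?thesis .
qed

text \<open>Duality without any dual space: the adjoint image is paired with its own extremal
  vector. Cauchy-Schwarz and the bound for \<open>K\<close> give \<open>S^2 \<le> V * C * S\<close>,
  and one factor \<open>S\<close> cancels, so the constant is preserved.\<close>

lemma mat_bound_adjoint:
  fixes w :: "'i \<Rightarrow> real"
  assumes w: "\<And>i. w i > 0" and C: "C \<ge> 0" and K: "mat_bound w K C"
  shows "mat_bound (\<lambda>i. 1 / w i) (\<lambda>i j. cnj (K j i)) C"
  unfolding mat_bound_def
proof (intro allI impI)
  fix E F :: "'i set" and v :: "'i \<Rightarrow> complex"
  assume E: "finite E" and F: "finite F"
  define y where "y i = (\<Sum>j\<in>E. cnj (K j i) * v j)" for i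
  \<comment> \<open>The extremal vector: its pairing with \<open>y\<close> is \<open>S\<close>, and
    its squared norm for the weight \<open>w\<close> is \<open>S\<close> again.\<close>
  define z where "z i = y i / of_real (w i)" for i
  define S where "S = (\<Sum>i\<in>F. 1 / w i * (cmod (y i))\<^sup>2)"
  define V where "V = (\<Sum>j\<in>E. 1 / w j * (cmod (v j))\<^sup>2)"
  have S0: "S \<ge> 0" and V0: "V \<ge> 0"
    unfolding S_def V_def using w by (auto intro!: sum_nonneg simp: less_imp_le)
  have wz: "w i * (cmod (z i))\<^sup>2 = 1 / w i * (cmod (y i))\<^sup>2" for i
    using w[of i] by (simp add: z_def norm_divide power_divide power2_eq_square)
  have "of_real S = (\<Sum>i\<in>F. cnj (z i) * y i)"
    unfolding S_def of_real_sum
  proof (intro sum.cong refl)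
    fix i
    have "complex_of_real ((cmod (y i))\<^sup>2) = y i * cnj (y i)"
      by (rule complex_norm_square)
    then show "complex_of_real (1 / w i * (cmod (y i))\<^sup>2) = cnj (z i) * y i"
      by (simp add: z_def)
  qed
  also have "\<dots> = (\<Sum>i\<in>F. \<Sum>j\<in>E. v j * cnj (K j i * z i))"
    by (simp add: y_def sum_distrib_left mult_ac)
  also have "\<dots> = (\<Sum>j\<in>E. v j * cnj (\<Sum>i\<in>F. K j i * z i))"
    by (subst sum.swap) (simp add: sum_distrib_left)
  finally have "S\<^sup>2 = (cmod (\<Sum>j\<in>E. v j * cnj (\<Sum>i\<in>F. K j i * z i)))\<^sup>2"
    using S0 by (metis norm_of_real power2_abs)
  also have "\<dots> \<le> (\<Sum>j\<in>E. (cmod (v j))\<^sup>2 / w j) * (\<Sum>j\<in>E. w j * (cmod (cnj (\<Sum>i\<in>F. K j i * z i)))\<^sup>2)"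
    by (rule cmod_sum_mult_le) (rule w)
  also have "\<dots> = V * (\<Sum>j\<in>E. w j * (cmod (\<Sum>i\<in>F. K j i * z i))\<^sup>2)"
    unfolding V_def complex_mod_cnj by simp
  also have "\<dots> \<le> V * (C * (\<Sum>i\<in>F. w i * (cmod (z i))\<^sup>2))"
    by (intro mult_left_mono mat_boundD[OF K] E F V0)
  also have "(\<Sum>i\<in>F. w i * (cmod (z i))\<^sup>2) = S"
    by (simp only: wz S_def)
  finally have "S * S \<le> (C * V) * S"
    by (simp add: power2_eq_square mult_ac)
  then have "S \<le> C * V"
    using S0 C V0 by (cases "S = 0") (auto simp: mult_le_cancel_right)
  then show "(\<Sum>i\<in>F. 1 / w i * (cmod (\<Sum>j\<in>E. cnj (K j i) * v j))\<^sup>2)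
      \<le> C * (\<Sum>j\<in>E. 1 / w j * (cmod (v j))\<^sup>2)"
    by (simp add: S_def V_def y_def)
qed

lemma cmod_add_power2_le: "(cmod (a + b))\<^sup>2 \<le> 2 * (cmod a)\<^sup>2 + 2 * (cmod b)\<^sup>2"
proof -
  have "(cmod (a + b))\<^sup>2 \<le> (cmod a + cmod b)\<^sup>2"
    by (intro power_mono norm_triangle_ineq) auto
  also have "\<dots> \<le> 2 * (cmod a)\<^sup>2 + 2 * (cmod b)\<^sup>2"
    using sum_squares_bound[of "cmod a" "cmod b"] by (simp add: power2_sum)
  finally show ?thesis .
qed

text \<open>Each component of the vector is assigned to the weight that realises the minimum there.
  On the output side the minimum is at most either weight, so each part uses its own bound. The
  scalars \<open>a\<close> and \<open>b\<close> cancel from the constant, and the 2 comes from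
  \<open>cmod_add_power2_le\<close>.\<close>

lemma mat_bound_min:
  fixes w0 w1 :: "'i \<Rightarrow> real"
  assumes K0: "mat_bound w0 K C" and K1: "mat_bound w1 K C"
    and c: "a \<ge> 0" "b \<ge> 0" and w: "\<And>i. w0 i \<ge> 0" "\<And>i. w1 i \<ge> 0"
  shows "mat_bound (\<lambda>i. min (a * w0 i) (b * w1 i)) K (2 * C)"
  unfolding mat_bound_def
proof (intro allI impI)
  fix E F :: "'i set" and v :: "'i \<Rightarrow> complex"
  assume E: "finite E" and F: "finite F"
  define P where "P j \<longleftrightarrow> a * w0 j \<le> b * w1 j" for j
  define v0 v1 where "v0 j = (if P j then v j else 0)" and "v1 j = (if P j then 0 else v j)" for j
  have v: "v j = v0 j + v1 j" for j by (simp add: v0_def v1_def)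
  let ?T = "\<lambda>v i. \<Sum>j\<in>E. K i j * v j"
  have T: "?T v i = ?T v0 i + ?T v1 i" for i
    by (simp add: v distrib_left sum.distrib)
  have "(\<Sum>i\<in>F. min (a * w0 i) (b * w1 i) * (cmod (?T v i))\<^sup>2)
      \<le> (\<Sum>i\<in>F. 2 * a * (w0 i * (cmod (?T v0 i))\<^sup>2) + 2 * b * (w1 i * (cmod (?T v1 i))\<^sup>2))"
  proof (intro sum_mono)
    fix i
    let ?m = "min (a * w0 i) (b * w1 i)"
    have m: "?m \<ge> 0" using c w by simp
    have "?m * (cmod (?T v i))\<^sup>2 \<le> ?m * (2 * (cmod (?T v0 i))\<^sup>2 + 2 * (cmod (?T v1 i))\<^sup>2)"
      unfolding T by (intro mult_left_mono cmod_add_power2_le m)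
    also have "\<dots> = ?m * (2 * (cmod (?T v0 i))\<^sup>2) + ?m * (2 * (cmod (?T v1 i))\<^sup>2)"
      by (simp add: distrib_left)
    also have "\<dots> \<le> (a * w0 i) * (2 * (cmod (?T v0 i))\<^sup>2) + (b * w1 i) * (2 * (cmod (?T v1 i))\<^sup>2)"
      by (intro add_mono mult_right_mono) auto
    finally show "?m * (cmod (?T v i))\<^sup>2
        \<le> 2 * a * (w0 i * (cmod (?T v0 i))\<^sup>2) + 2 * b * (w1 i * (cmod (?T v1 i))\<^sup>2)"
      by (simp add: mult_ac)
  qed
  also have "\<dots> = 2 * a * (\<Sum>i\<in>F. w0 i * (cmod (?T v0 i))\<^sup>2) + 2 * b * (\<Sum>i\<in>F. w1 i * (cmod (?T v1 i))\<^sup>2)"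
    by (simp add: sum.distrib sum_distrib_left)
  also have "\<dots> \<le> 2 * a * (C * (\<Sum>j\<in>E. w0 j * (cmod (v0 j))\<^sup>2)) + 2 * b * (C * (\<Sum>j\<in>E. w1 j * (cmod (v1 j))\<^sup>2))"
    using c by (intro add_mono mult_left_mono mat_boundD[OF K0] mat_boundD[OF K1] E F) auto
  also have "\<dots> = 2 * C * (\<Sum>j\<in>E. a * w0 j * (cmod (v0 j))\<^sup>2 + b * w1 j * (cmod (v1 j))\<^sup>2)"
    by (simp add: sum.distrib sum_distrib_left mult_ac distrib_left)
  also have "(\<Sum>j\<in>E. a * w0 j * (cmod (v0 j))\<^sup>2 + b * w1 j * (cmod (v1 j))\<^sup>2)
      = (\<Sum>j\<in>E. min (a * w0 j) (b * w1 j) * (cmod (v j))\<^sup>2)"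
    by (intro sum.cong refl) (auto simp: v0_def v1_def P_def min_def)
  finally show "(\<Sum>i\<in>F. min (a * w0 i) (b * w1 i) * (cmod (?T v i))\<^sup>2)
      \<le> 2 * C * (\<Sum>j\<in>E. min (a * w0 j) (b * w1 j) * (cmod (v j))\<^sup>2)" .
qed

text \<open>
  Interpolation between the weights \<open>W powr N\<close> and \<open>W powr (- N)\<close>: the sum over \<open>j\<close> of
  \<open>2 powr (j s) * min (q powr N) (q powr (- N)), q = W / 2 ^ j,\<close> is comparable to \<open>W powr s\<close>, and \<open>mat_bound_min\<close> treats each summand by
  cutting the vector at \<open>W = 2\<^sup>j\<close>.
\<close>

definition dyadic_weight :: "real \<Rightarrow> real \<Rightarrow> nat \<Rightarrow> real \<Rightarrow> real" where
  "dyadic_weight N s j x =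
     (2 ^ j) powr s * min ((1 / 2 ^ j) powr N * x powr N) ((1 / 2 ^ j) powr (- N) * x powr (- N))"

text \<open>The exponent is the distance of \<open>j\<close> and \<open>m\<close>, written for
  natural numbers; each side of \<open>m\<close> is a geometric series of sum at most 2.\<close>

lemma sum_half_power_dist_le: "(\<Sum>j\<le>J. (1 / 2 :: real) ^ (if j \<le> m then m - j else j - m)) \<le> 4"
proof -
  have *: "(\<Sum>j\<le>n. (1 / 2 :: real) ^ j) \<le> 2" for n
    using sum_gp0[of "1 / 2 :: real" n] by simp
  have "(\<Sum>j\<le>J. (1 / 2 :: real) ^ (if j \<le> m then m - j else j - m))
      \<le> (\<Sum>j\<le>m + J. (1 / 2 :: real) ^ (if j \<le> m then m - j else j - m))"
    by (intro sum_mono2) auto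
  also have "\<dots> \<le> (\<Sum>j\<le>m. (1 / 2 :: real) ^ (m - j)) + (\<Sum>j\<le>J. (1 / 2 :: real) ^ j)"
  proof -
    have "{..m + J} = {..m} \<union> {m<..m + J}" by auto
    then have "(\<Sum>j\<le>m + J. (1 / 2 :: real) ^ (if j \<le> m then m - j else j - m))
       = (\<Sum>j\<le>m. (1 / 2 :: real) ^ (m - j)) + (\<Sum>j\<in>{m<..m + J}. (1 / 2 :: real) ^ (j - m))"
      by (simp only:) (subst sum.union_disjoint, auto intro!: arg_cong2[where f="(+)"] sum.cong)
    also have "(\<Sum>j\<in>{m<..m + J}. (1 / 2 :: real) ^ (j - m)) = (\<Sum>j\<in>{0<..J}. (1 / 2 :: real) ^ j)"
      by (rule sum.reindex_bij_witness[of _ "\<lambda>j. j + m" "\<lambda>j. j - m"]) auto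
    also have "\<dots> \<le> (\<Sum>j\<le>J. (1 / 2 :: real) ^ j)"
      by (intro sum_mono2) auto
    finally show ?thesis by simp
  qed
  also have "(\<Sum>j\<le>m. (1 / 2 :: real) ^ (m - j)) = (\<Sum>j\<le>m. (1 / 2 :: real) ^ j)"
    by (rule sum.nat_diff_reindex[of _ "Suc m", unfolded lessThan_Suc_atMost, simplified])
  finally show ?thesis using *[of m] *[of J] by simp
qed

lemma dyadic_floor:
  fixes x :: real
  assumes "x \<ge> 1"
  obtains m :: nat where "2 ^ m \<le> x" "x < 2 ^ Suc m"
proof -
  obtain n where n: "x < 2 ^ n" using real_arch_pow[of 2 x] by auto
  define k where "k = (LEAST n. x < 2 ^ n)"
  have k: "x < 2 ^ k" unfolding k_def using n by (rule LeastI)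
  then have "k \<noteq> 0" using assms by (intro notI) simp
  then obtain m where m: "k = Suc m" by (cases k) auto
  have "\<not> x < 2 ^ m" unfolding not_less using not_less_Least[of m "\<lambda>n. x < 2 ^ n"] m k_def by auto
  then show ?thesis using that[of m] k m by auto
qed

text \<open>With \<open>q = x / 2 ^ j\<close> one has
  \<open>(2 ^ j) powr s = x powr s * q powr (- s)\<close>. What remains beside
  \<open>x powr s\<close> is a function of \<open>q\<close> alone, which can be summed over
  \<open>j\<close>.\<close>

lemma dyadic_weight_eq:
  assumes "x > 0"
  shows "dyadic_weight N s j x = x powr s *
    (x / 2 ^ j) powr (- s) * min ((x / 2 ^ j) powr N) ((x / 2 ^ j) powr (- N))"
proof -
  have a: "(1 / 2 ^ j) powr r * x powr r = (x / 2 ^ j) powr r" for r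
    using assms by (simp add: powr_divide)
  have b: "(2 ^ j) powr s = x powr s * (x / 2 ^ j) powr (- s)"
    using assms by (simp add: powr_divide powr_minus field_simps)
  show ?thesis unfolding dyadic_weight_def a b by simp
qed

text \<open>The margin 1 in \<open>N \<ge> \<bar>s\<bar> + 1\<close> leaves a factor
  \<open>min q (1 / q)\<close>, where \<open>q = x / 2 ^ j\<close>. It decays geometrically away
  from the dyadic scale \<open>m\<close> of \<open>x\<close>, up to a factor 2 because
  \<open>x\<close> may be nearly \<open>2 ^ Suc m\<close>. Hence 8 is 2 times the 4 of
  \<open>sum_half_power_dist_le\<close>.\<close>

lemma sum_dyadic_weight_upper:
  assumes "x \<ge> 1" "N \<ge> \<bar>s\<bar> + 1"
  shows "(\<Sum>j\<le>J. dyadic_weight N s j x) \<le> 8 * x powr s"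
proof -
  obtain m where m: "2 ^ m \<le> x" "x < 2 ^ Suc m" using dyadic_floor assms(1) by blast
  have "dyadic_weight N s j x \<le> x powr s * (2 * (1 / 2) ^ (if j \<le> m then m - j else j - m))" for j
  proof -
    define y where "y = x / 2 ^ j"
    have y: "y > 0" using assms by (simp add: y_def)
    have 1: "y powr (- s) * min (y powr N) (y powr (- N)) \<le> min y (1 / y)"
    proof (cases "y \<ge> 1")
      case True
      have "y powr (- s) * min (y powr N) (y powr (- N)) \<le> y powr (- s) * y powr (- N)"
        by (intro mult_left_mono) auto
      also have "\<dots> = y powr (- s - N)" by (simp add: powr_add[symmetric])
      also have "\<dots> \<le> y powr (- 1)" using True assms by (intro powr_mono) auto
      finally have *: "y powr (- s) * min (y powr N) (y powr (- N)) \<le> 1 / y"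
        using y by (simp add: powr_minus_divide)
      have "1 / y \<le> 1" using True by simp
      then have "1 / y \<le> y" using True by linarith
      then show ?thesis using * by simp
    next
      case False
      have "y powr (- s) * min (y powr N) (y powr (- N)) \<le> y powr (- s) * y powr N"
        by (intro mult_left_mono) auto
      also have "\<dots> = y powr (- s + N)" by (simp add: powr_add[symmetric])
      also have "\<dots> \<le> y powr 1" using False y assms by (intro powr_mono') auto
      finally have *: "y powr (- s) * min (y powr N) (y powr (- N)) \<le> y" using y by simp
      have "y * y \<le> 1" using False y by (simp add: mult_le_one)
      then have "y \<le> 1 / y" using y by (simp add: divide_simps)
      then show ?thesis using * by simp
    qed
    have 2: "min y (1 / y) \<le> 2 * (1 / 2) ^ (if j \<le> m then m - j else j - m)"
    proof (cases "j \<le> m")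
      case True
      have "1 / y = 2 ^ j / x" by (simp add: y_def)
      also have "\<dots> \<le> 2 ^ j / 2 ^ m" using m by (intro divide_left_mono) auto
      also have "\<dots> = (1 / 2) ^ (m - j)" using True by (simp add: power_diff power_one_over field_simps)
      finally have "1 / y \<le> 2 * (1 / 2) ^ (m - j)" by (rule order_trans) simp
      then show ?thesis using True by simp
    next
      case False
      have "y \<le> 2 ^ Suc m / 2 ^ j" unfolding y_def using m by (intro divide_right_mono) auto
      also have "\<dots> = 2 * (1 / 2) ^ (j - m)" using False by (simp add: power_diff power_one_over field_simps)
      finally show ?thesis using False by simp
    qed
    have "dyadic_weight N s j x = x powr s * (y powr (- s) * min (y powr N) (y powr (- N)))"
      using assms by (simp add: dyadic_weight_eq y_def mult_ac)
    also have "\<dots> \<le> x powr s * (2 * (1 / 2) ^ (if j \<le> m then m - j else j - m))"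
      using order_trans[OF 1 2] by (intro mult_left_mono) auto
    finally show ?thesis .
  qed
  then have "(\<Sum>j\<le>J. dyadic_weight N s j x)
      \<le> (\<Sum>j\<le>J. x powr s * (2 * (1 / 2) ^ (if j \<le> m then m - j else j - m)))"
    by (intro sum_mono)
  also have "\<dots> = 2 * x powr s * (\<Sum>j\<le>J. (1 / 2) ^ (if j \<le> m then m - j else j - m))"
    by (simp add: sum_distrib_left mult_ac)
  also have "\<dots> \<le> 2 * x powr s * 4"
    by (intro mult_left_mono sum_half_power_dist_le) auto
  finally show ?thesis by simp
qed

lemma dyadic_weight_nonneg: "dyadic_weight N s j x \<ge> 0"
  by (auto simp: dyadic_weight_def)

text \<open>The single summand at the dyadic scale \<open>m\<close> of \<open>x\<close> suffices:
  there \<open>x / 2 ^ m\<close> lies between 1 and 2, which costs at most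
  \<open>2 powr (- \<bar>s\<bar> - N)\<close>. The bound \<open>x \<le> 2 ^ J\<close> ensures that
  this summand is present.\<close>

lemma sum_dyadic_weight_lower:
  assumes "x \<ge> 1" "x \<le> 2 ^ J" "N \<ge> 0"
  shows "2 powr (- \<bar>s\<bar> - N) * x powr s \<le> (\<Sum>j\<le>J. dyadic_weight N s j x)"
proof -
  obtain m where m: "2 ^ m \<le> x" "x < 2 ^ Suc m" using dyadic_floor assms(1) by blast
  have "m \<le> J"
    using order_trans[OF m(1) assms(2)] by simp
  define y where "y = x / 2 ^ m"
  have y: "1 \<le> y" "y \<le> 2" using m by (auto simp: y_def field_simps)
  have "2 powr (- \<bar>s\<bar>) \<le> y powr (- s)"
  proof (cases "s \<ge> 0")
    case True
    then show ?thesis using y by (auto intro: powr_mono2')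
  next
    case False
    have "2 powr (- \<bar>s\<bar>) \<le> 2 powr (0 :: real)" by (intro powr_mono) auto
    also have "\<dots> \<le> y powr (- s)" using False y by (simp add: ge_one_powr_ge_zero)
    finally show ?thesis .
  qed
  moreover have "2 powr (- N) \<le> y powr (- N)" using y assms by (auto intro: powr_mono2')
  moreover have "y powr (- N) \<le> y powr N" using y assms by (intro powr_mono) auto
  ultimately have "2 powr (- \<bar>s\<bar>) * 2 powr (- N) \<le> y powr (- s) * min (y powr N) (y powr (- N))"
    by (intro mult_mono) auto
  then have "x powr s * (2 powr (- \<bar>s\<bar>) * 2 powr (- N)) \<le> x powr s * (y powr (- s) * min (y powr N) (y powr (- N)))"
    by (intro mult_left_mono) auto
  also have "\<dots> = dyadic_weight N s m x" using assms by (simp add: dyadic_weight_eq y_def mult_ac)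
  also have "\<dots> \<le> (\<Sum>j\<le>J. dyadic_weight N s j x)"
    using \<open>m \<le> J\<close> by (intro member_le_sum) (auto simp: dyadic_weight_nonneg)
  finally show ?thesis by (simp add: powr_diff powr_minus field_simps)
qed

lemma mat_bound_interpolate:
  fixes W :: "'i \<Rightarrow> real"
  assumes W: "\<And>i. W i \<ge> 1" and C: "C \<ge> 0" and N: "N \<ge> \<bar>s\<bar> + 1"
    and K0: "mat_bound (\<lambda>i. W i powr N) K C" and K1: "mat_bound (\<lambda>i. W i powr (- N)) K C"
  shows "mat_bound (\<lambda>i. W i powr s) K (2 powr (\<bar>s\<bar> + N) * (16 * C))"
  unfolding mat_bound_def
proof (intro allI impI)
  fix E F :: "'i set" and v :: "'i \<Rightarrow> complex"
  assume E: "finite E" and F: "finite F"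
  let ?T = "\<lambda>i. \<Sum>j\<in>E. K i j * v j"
  \<comment> \<open>\<open>J\<close> depends on the output rows only. The lower bound for the dyadic
    sum is needed on \<open>F\<close>, while the upper bound, used on \<open>E\<close>, holds for
    every \<open>J\<close>.\<close>
  obtain J where J: "\<And>i. i \<in> F \<Longrightarrow> W i \<le> 2 ^ J"
  proof -
    obtain J where "(\<Sum>i\<in>F. W i) < 2 ^ J" using real_arch_pow[of 2] by auto
    moreover have "W i \<le> (\<Sum>i\<in>F. W i)" if "i \<in> F" for i
      using F that W by (intro member_le_sum) (auto intro: order_trans[OF zero_le_one])
    ultimately show ?thesis using that[of J] by force
  qed
  let ?c = "2 powr (- \<bar>s\<bar> - N)"
  have "?c * (\<Sum>i\<in>F. W i powr s * (cmod (?T i))\<^sup>2) = (\<Sum>i\<in>F. (?c * W i powr s) * (cmod (?T i))\<^sup>2)"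
    by (simp add: sum_distrib_left mult_ac)
  also have "\<dots> \<le> (\<Sum>i\<in>F. (\<Sum>j\<le>J. dyadic_weight N s j (W i)) * (cmod (?T i))\<^sup>2)"
    using N by (intro sum_mono mult_right_mono sum_dyadic_weight_lower W J) auto
  also have "\<dots> = (\<Sum>j\<le>J. \<Sum>i\<in>F. dyadic_weight N s j (W i) * (cmod (?T i))\<^sup>2)"
    by (subst sum.swap) (simp add: sum_distrib_right)
  also have "\<dots> \<le> (\<Sum>j\<le>J. 2 * C * (\<Sum>i\<in>E. dyadic_weight N s j (W i) * (cmod (v i))\<^sup>2))"
  proof (intro sum_mono)
    fix j
    let ?m = "\<lambda>i. min ((1 / 2 ^ j) powr N * W i powr N) ((1 / 2 ^ j) powr (- N) * W i powr (- N))"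
    have "(\<Sum>i\<in>F. ?m i * (cmod (?T i))\<^sup>2) \<le> 2 * C * (\<Sum>i\<in>E. ?m i * (cmod (v i))\<^sup>2)"
      by (intro mat_boundD[OF mat_bound_min] K0 K1 E F) auto
    then have "(2 ^ j) powr s * (\<Sum>i\<in>F. ?m i * (cmod (?T i))\<^sup>2)
        \<le> (2 ^ j) powr s * (2 * C * (\<Sum>i\<in>E. ?m i * (cmod (v i))\<^sup>2))"
      by (intro mult_left_mono) auto
    then show "(\<Sum>i\<in>F. dyadic_weight N s j (W i) * (cmod (?T i))\<^sup>2)
        \<le> 2 * C * (\<Sum>i\<in>E. dyadic_weight N s j (W i) * (cmod (v i))\<^sup>2)"
      by (simp add: dyadic_weight_def sum_distrib_left mult_ac)
  qed
  also have "\<dots> = 2 * C * (\<Sum>i\<in>E. (\<Sum>j\<le>J. dyadic_weight N s j (W i)) * (cmod (v i))\<^sup>2)"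
    by (simp only: sum_distrib_right sum_distrib_left[symmetric])
      (subst sum.swap, simp)
  also have "\<dots> \<le> 2 * C * (\<Sum>i\<in>E. 8 * W i powr s * (cmod (v i))\<^sup>2)"
    using C N W by (intro mult_left_mono sum_mono mult_right_mono sum_dyadic_weight_upper) auto
  also have "\<dots> = 16 * C * (\<Sum>i\<in>E. W i powr s * (cmod (v i))\<^sup>2)"
    by (simp add: sum_distrib_left mult_ac)
  finally have "2 powr (\<bar>s\<bar> + N) * (?c * (\<Sum>i\<in>F. W i powr s * (cmod (?T i))\<^sup>2))
      \<le> 2 powr (\<bar>s\<bar> + N) * (16 * C * (\<Sum>i\<in>E. W i powr s * (cmod (v i))\<^sup>2))"
    by (intro mult_left_mono) auto
  moreover have "2 powr (\<bar>s\<bar> + N) * ?c = 1" by (simp add: powr_add[symmetric])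
  ultimately show "(\<Sum>i\<in>F. W i powr s * (cmod (?T i))\<^sup>2)
      \<le> 2 powr (\<bar>s\<bar> + N) * (16 * C) * (\<Sum>j\<in>E. W j powr s * (cmod (v j))\<^sup>2)"
    by (simp add: mult.assoc[symmetric])
qed

section \<open>Smooth and test functions\<close>

lemma dir_deriv_eqI: "(f has_derivative f') (at z) \<Longrightarrow> dir_deriv v f z = f' v"
  unfolding dir_deriv_def by (metis frechet_derivative_at)

lemma has_derivative_dir_deriv:
  "f differentiable (at z) \<Longrightarrow> (f has_derivative (\<lambda>v. dir_deriv v f z)) (at z)"
  unfolding dir_deriv_def using frechet_derivative_works by blast

lemma has_vector_derivative_dir_deriv:
  fixes f :: "real \<Rightarrow> 'b::real_normed_vector"
  assumes "f differentiable (at t)"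
  shows "(f has_vector_derivative dir_deriv 1 f t) (at t)"
proof -
  have *: "(f has_derivative (\<lambda>v. dir_deriv v f t)) (at t)"
    using assms by (rule has_derivative_dir_deriv)
  have "dir_deriv v f t = v *\<^sub>R dir_deriv 1 f t" for v
    using linear_cmul[OF has_derivative_linear[OF *], of v 1]
    by (simp only: real_scaleR_def mult_1_right)
  then have "(\<lambda>v. dir_deriv v f t) = (\<lambda>v. v *\<^sub>R dir_deriv 1 f t)"
    by (rule ext)
  with * show ?thesis by (simp only: has_vector_derivative_def)
qed

lemma dir_deriv_1_eqI:
  fixes f :: "real \<Rightarrow> 'b::real_normed_vector"
  shows "(f has_vector_derivative d) (at t) \<Longrightarrow> dir_deriv 1 f t = d"
  using dir_deriv_eqI[of f "\<lambda>x. x *\<^sub>R d" t 1] by (simp add: has_vector_derivative_def)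

text \<open>The product rule and the derivative of \<open>exp\<close> leave an undifferentiated
  factor behind, which the induction step needs with one degree of smoothness less.\<close>

lemma C_k_Suc_imp: "C_k (Suc k) f \<Longrightarrow> C_k k f"
proof (induction k arbitrary: f)
  case 0
  then show ?case
    by (auto intro!: continuous_at_imp_continuous_on differentiable_imp_continuous_within)
next
  case (Suc k)
  from Suc.prems have "C_k (Suc k) (dir_deriv v f)" for v
    unfolding C_k.simps(2)[of "Suc k"] by blast
  then show ?case using Suc.IH Suc.prems by simp
qed

lemma C_k_const: "C_k k (\<lambda>_. c)"
proof (induction k arbitrary: c)
  case (Suc k)
  have "dir_deriv v (\<lambda>_. c) = (\<lambda>_. 0)" for v :: 'a
    by (rule ext) (rule dir_deriv_eqI, rule has_derivative_const)
  with Suc show ?case by simp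
qed simp

lemma dir_deriv_add:
  assumes "\<And>z. f differentiable (at z)" "\<And>z. g differentiable (at z)"
  shows "dir_deriv v (\<lambda>z. f z + g z) = (\<lambda>z. dir_deriv v f z + dir_deriv v g z)"
  by (rule ext, rule dir_deriv_eqI)
    (intro has_derivative_add has_derivative_dir_deriv assms)

lemma C_k_add: "C_k k f \<Longrightarrow> C_k k g \<Longrightarrow> C_k k (\<lambda>z. f z + g z)"
  by (induction k arbitrary: f g) (auto intro!: continuous_intros simp: dir_deriv_add)

lemma dir_deriv_mult:
  fixes f g :: "'a::euclidean_space \<Rightarrow> 'b::real_normed_algebra"
  assumes "\<And>z. f differentiable (at z)" "\<And>z. g differentiable (at z)"
  shows "dir_deriv v (\<lambda>z. f z * g z) = (\<lambda>z. f z * dir_deriv v g z + dir_deriv v f z * g z)"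
  by (rule ext, rule dir_deriv_eqI)
    (intro has_derivative_mult has_derivative_dir_deriv assms)

lemma C_k_mult:
  fixes f g :: "'a::euclidean_space \<Rightarrow> 'b::real_normed_algebra"
  shows "C_k k f \<Longrightarrow> C_k k g \<Longrightarrow> C_k k (\<lambda>z. f z * g z)"
proof (induction k arbitrary: f g)
  case (Suc k)
  have "C_k k f" "C_k k g" using Suc.prems C_k_Suc_imp by blast+
  then show ?case using Suc by (auto simp: dir_deriv_mult intro!: C_k_add)
qed (auto intro!: continuous_intros)

lemma C_k_linear_compose:
  assumes L: "bounded_linear L"
  shows "C_k k f \<Longrightarrow> C_k k (\<lambda>z. L (f z))"
proof (induction k arbitrary: f)
  case 0
  then show ?case using L by (auto intro: bounded_linear.continuous_on)
next
  case (Suc k)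
  have d: "((\<lambda>z. L (f z)) has_derivative (\<lambda>v. L (dir_deriv v f z))) (at z)" for z
    using Suc.prems by (intro bounded_linear.has_derivative[OF L] has_derivative_dir_deriv) simp
  then have "dir_deriv v (\<lambda>z. L (f z)) = (\<lambda>z. L (dir_deriv v f z))" for v
    by (intro ext dir_deriv_eqI)
  with d Suc show ?case by (auto simp: differentiable_def)
qed

lemma C_k_compose_linear:
  assumes L: "bounded_linear L"
  shows "C_k k f \<Longrightarrow> C_k k (\<lambda>z. f (L z))"
proof (induction k arbitrary: f)
  case 0
  then show ?case
    using continuous_on_compose2[of UNIV f UNIV L] linear_continuous_on[OF L] by simp
next
  case (Suc k)
  have d: "((\<lambda>z. f (L z)) has_derivative (\<lambda>v. dir_deriv (L v) f (L z))) (at z)" for z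
    using Suc.prems
    by (intro has_derivative_compose[OF bounded_linear_imp_has_derivative[OF L] has_derivative_dir_deriv]) simp
  then have "dir_deriv v (\<lambda>z. f (L z)) = (\<lambda>z. dir_deriv (L v) f (L z))" for v
    by (intro ext dir_deriv_eqI)
  with d Suc show ?case by (auto simp: differentiable_def)
qed

lemma dir_deriv_exp:
  fixes f :: "'a::euclidean_space \<Rightarrow> complex"
  assumes "\<And>z. f differentiable (at z)"
  shows "((\<lambda>z. exp (f z)) has_derivative (\<lambda>v. exp (f z) * dir_deriv v f z)) (at z)"
  and "dir_deriv v (\<lambda>z. exp (f z)) = (\<lambda>z. exp (f z) * dir_deriv v f z)"
proof -
  show *: "((\<lambda>z. exp (f z)) has_derivative (\<lambda>v. exp (f z) * dir_deriv v f z)) (at z)" for z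
    using has_derivative_compose[OF has_derivative_dir_deriv[OF assms]
        DERIV_exp[of "f z", unfolded has_field_derivative_def]]
    by simp
  show "dir_deriv v (\<lambda>z. exp (f z)) = (\<lambda>z. exp (f z) * dir_deriv v f z)"
    by (rule ext, rule dir_deriv_eqI, rule *)
qed

lemma C_k_exp:
  fixes f :: "'a::euclidean_space \<Rightarrow> complex"
  shows "C_k k f \<Longrightarrow> C_k k (\<lambda>z. exp (f z))"
proof (induction k)
  case (Suc k)
  have "C_k k (\<lambda>z. exp (f z))" using Suc C_k_Suc_imp by blast
  moreover have "(\<lambda>z. exp (f z)) differentiable at z" for z
    using dir_deriv_exp(1)[of f z] Suc.prems by (auto simp: differentiable_def)
  ultimately show ?case using Suc.prems by (auto simp: dir_deriv_exp(2) intro!: C_k_mult)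
qed (auto intro!: continuous_intros)

lemma C_infinityD:
  assumes "C_infinity f"
  shows "f differentiable (at z)" "C_infinity (dir_deriv v f)" "continuous_on S f"
proof -
  have "C_k (Suc k) f" for k using assms by (simp add: C_infinity_def)
  then show "f differentiable (at z)" "C_infinity (dir_deriv v f)" by (auto simp: C_infinity_def)
  have "C_k 0 f" using assms unfolding C_infinity_def by blast
  then show "continuous_on S f" by (auto intro: continuous_on_subset)
qed

lemma C_infinity_const: "C_infinity (\<lambda>_. c)"
  by (simp add: C_infinity_def C_k_const)

lemma C_infinity_add: "C_infinity f \<Longrightarrow> C_infinity g \<Longrightarrow> C_infinity (\<lambda>z. f z + g z)"
  by (simp add: C_infinity_def C_k_add)

lemma C_infinity_mult:
  fixes f g :: "'a::euclidean_space \<Rightarrow> 'b::real_normed_algebra"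
  shows "C_infinity f \<Longrightarrow> C_infinity g \<Longrightarrow> C_infinity (\<lambda>z. f z * g z)"
  by (simp add: C_infinity_def C_k_mult)

lemma C_infinity_linear_compose:
  "bounded_linear L \<Longrightarrow> C_infinity f \<Longrightarrow> C_infinity (\<lambda>z. L (f z))"
  by (simp add: C_infinity_def C_k_linear_compose)

lemma C_infinity_compose_linear:
  "bounded_linear L \<Longrightarrow> C_infinity f \<Longrightarrow> C_infinity (\<lambda>z. f (L z))"
  by (simp add: C_infinity_def C_k_compose_linear)

lemma C_infinity_exp:
  fixes f :: "'a::euclidean_space \<Rightarrow> complex"
  shows "C_infinity f \<Longrightarrow> C_infinity (\<lambda>z. exp (f z))"
  by (simp add: C_infinity_def C_k_exp)

lemma C_infinity_ident: "C_infinity (\<lambda>z. z)"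
  unfolding C_infinity_def
proof
  fix k
  have *: "dir_deriv v (\<lambda>z. z) = (\<lambda>_. v)" for v :: 'a
    by (rule ext, rule dir_deriv_eqI, rule has_derivative_ident)
  show "C_k k (\<lambda>z. z :: 'a)"
    by (cases k) (auto simp: * C_k_const intro!: continuous_intros)
qed

lemma C_infinity_linear: "bounded_linear L \<Longrightarrow> C_infinity L"
  by (rule C_infinity_linear_compose[OF _ C_infinity_ident])

section \<open>Smooth periodic functions of one variable\<close>

definition smooth_periodic :: "(real \<Rightarrow> complex) \<Rightarrow> bool" where
  "smooth_periodic h \<longleftrightarrow> C_infinity h \<and> (\<forall>t. h (t + 2 * pi) = h t)"

lemma dir_deriv_shift:
  fixes f :: "'a::euclidean_space \<Rightarrow> 'b::real_normed_vector"
  assumes "\<And>z. f (z + p) = f z" "\<And>z. f differentiable (at z)"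
  shows "dir_deriv v f (z + p) = dir_deriv v f z"
proof -
  have "((\<lambda>z. f (z + p)) has_derivative (\<lambda>v. dir_deriv v f (z + p))) (at z)"
    by (rule has_derivative_compose[of "\<lambda>z. z + p" "\<lambda>v. v", OF _ has_derivative_dir_deriv])
      (auto intro!: derivative_eq_intros assms)
  then show ?thesis using assms(1) by (simp add: dir_deriv_eqI)
qed

lemma smooth_periodicD:
  assumes "smooth_periodic h"
  shows "smooth_periodic (dir_deriv 1 h)"
    "(h has_vector_derivative dir_deriv 1 h t) (at t)"
    "h (t + 2 * pi) = h t" "continuous_on S h"
  using assms dir_deriv_shift[of h "2 * pi"] has_vector_derivative_dir_deriv[of h t]
  by (auto simp: smooth_periodic_def C_infinityD)

lemma smooth_periodic_mult:
  "smooth_periodic f \<Longrightarrow> smooth_periodic g \<Longrightarrow> smooth_periodic (\<lambda>t. f t * g t)"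
  by (auto simp: smooth_periodic_def C_infinity_mult)

lemma smooth_periodic_const: "smooth_periodic (\<lambda>_. c)"
  by (auto simp: smooth_periodic_def C_infinity_const)

lemma smooth_periodic_add:
  "smooth_periodic f \<Longrightarrow> smooth_periodic g \<Longrightarrow> smooth_periodic (\<lambda>t. f t + g t)"
  by (auto simp: smooth_periodic_def C_infinity_add)

lemma smooth_periodic_of_real: "smooth_circle_fun A \<Longrightarrow> smooth_periodic (\<lambda>t. complex_of_real (A t))"
  by (auto simp: smooth_periodic_def smooth_circle_fun_def
      intro: C_infinity_linear_compose bounded_linear_of_real)

lemma smooth_circle_fun_deriv:
  "smooth_circle_fun A \<Longrightarrow> smooth_circle_fun (dir_deriv 1 A)"
  using dir_deriv_shift[of A "2 * pi"] by (auto simp: smooth_circle_fun_def C_infinityD)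

lemma smooth_circle_fun_minus: "smooth_circle_fun A \<Longrightarrow> smooth_circle_fun (\<lambda>t. - A t)"
  using C_infinity_linear_compose[of "\<lambda>x. - x" A, OF bounded_linear_minus[OF bounded_linear_ident]]
  by (simp add: smooth_circle_fun_def)

lemma smooth_periodic_exp_ii:
  assumes "smooth_circle_fun A"
  shows "smooth_periodic (\<lambda>t. exp (\<i> * complex_of_real (c * A t)))"
proof -
  have "C_infinity (\<lambda>t. (\<i> * complex_of_real c) * complex_of_real (A t))"
    using smooth_periodic_of_real[OF assms]
    by (intro C_infinity_mult C_infinity_const) (auto simp: smooth_periodic_def)
  then have "C_infinity (\<lambda>t. exp (\<i> * complex_of_real (c * A t)))"
    by (intro C_infinity_exp) (simp add: mult.assoc)
  then show ?thesis using assms by (simp add: smooth_periodic_def smooth_circle_fun_def)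
qed

lemma periodic_plus_int:
  fixes f :: "real \<Rightarrow> 'b"
  assumes "\<And>t. f (t + p) = f t"
  shows "f (t + of_int n * p) = f t"
proof (induction n rule: int_induct[of _ 0])
  case (step1 i)
  then show ?case using assms[of "t + of_int i * p"] by (simp add: algebra_simps)
next
  case (step2 i)
  then show ?case using assms[of "t + of_int (i - 1) * p"] by (simp add: algebra_simps)
qed simp

lemma reduce_to_period:
  obtains n :: int where "t + of_int n * (2 * pi) \<in> {0..2 * pi}"
proof
  let ?x = "t / (2 * pi)"
  have "0 \<le> ?x - \<lfloor>?x\<rfloor>" "?x - \<lfloor>?x\<rfloor> \<le> 1" by linarith+
  then have "0 \<le> (?x - \<lfloor>?x\<rfloor>) * (2 * pi)" "(?x - \<lfloor>?x\<rfloor>) * (2 * pi) \<le> 1 * (2 * pi)"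
    by (intro mult_nonneg_nonneg mult_right_mono; simp)+
  moreover have "(?x - \<lfloor>?x\<rfloor>) * (2 * pi) = t + of_int (- \<lfloor>?x\<rfloor>) * (2 * pi)"
    by (simp add: left_diff_distrib)
  ultimately show "t + of_int (- \<lfloor>?x\<rfloor>) * (2 * pi) \<in> {0..2 * pi}"
    by simp
qed

lemma smooth_periodic_bounded:
  assumes "smooth_periodic h"
  obtains B where "B \<ge> 0" "\<And>t. cmod (h t) \<le> B"
proof -
  have "compact (h ` {0..2 * pi})"
    using assms by (intro compact_continuous_image smooth_periodicD) auto
  then obtain B where B: "\<And>t. t \<in> {0..2 * pi} \<Longrightarrow> cmod (h t) \<le> B"
    using compact_imp_bounded bounded_iff by (metis imageI)
  have "cmod (h t) \<le> B" for t
  proof -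
    obtain n where "t + of_int n * (2 * pi) \<in> {0..2 * pi}" by (rule reduce_to_period)
    with B[OF this] show ?thesis
      using periodic_plus_int[of h "2 * pi" t n] smooth_periodicD(3)[OF assms] by simp
  qed
  moreover from this[of 0] have "B \<ge> 0" by (rule order_trans[OF norm_ge_zero])
  ultimately show ?thesis using that by blast
qed

section \<open>Test functions, their seminorms and their mixed derivatives\<close>

lemma test_fun_periodic:
  assumes "\<phi> \<in> test_funs"
  shows "\<phi> (z + (2 * pi, 0)) = \<phi> z" "\<phi> (z + (0, 2 * pi)) = \<phi> z"
  using assms by (cases z; simp add: test_funs_def)+

lemma test_funsI:
  assumes "C_infinity \<phi>" "\<And>z. \<phi> (z + (2 * pi, 0)) = \<phi> z" "\<And>z. \<phi> (z + (0, 2 * pi)) = \<phi> z"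
  shows "\<phi> \<in> test_funs"
  using assms(1) assms(2)[of "(t, x)" for t x] assms(3)[of "(t, x)" for t x] by (simp add: test_funs_def)

lemma test_funs_smooth: "\<phi> \<in> test_funs \<Longrightarrow> C_infinity \<phi>"
  by (simp add: test_funs_def)

lemma test_funs_differentiable: "\<phi> \<in> test_funs \<Longrightarrow> \<phi> differentiable (at z)"
  by (intro C_infinityD(1) test_funs_smooth)

lemma test_funs_add: "\<phi> \<in> test_funs \<Longrightarrow> \<psi> \<in> test_funs \<Longrightarrow> (\<lambda>z. \<phi> z + \<psi> z) \<in> test_funs"
  by (auto simp: test_funs_def C_infinity_add)

lemma test_funs_mult: "\<phi> \<in> test_funs \<Longrightarrow> \<psi> \<in> test_funs \<Longrightarrow> (\<lambda>z. \<phi> z * \<psi> z) \<in> test_funs"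
  by (auto simp: test_funs_def C_infinity_mult)

lemma test_funs_const: "(\<lambda>_. c) \<in> test_funs"
  by (auto simp: test_funs_def C_infinity_const)

lemma test_funs_cmult: "\<phi> \<in> test_funs \<Longrightarrow> (\<lambda>z. c * \<phi> z) \<in> test_funs"
  by (rule test_funs_mult[OF test_funs_const])

lemma test_funs_sum:
  "(\<And>i. i \<in> I \<Longrightarrow> f i \<in> test_funs) \<Longrightarrow> (\<lambda>z. \<Sum>i\<in>I. f i z) \<in> test_funs"
  by (induction I rule: infinite_finite_induct) (auto intro: test_funs_const test_funs_add)

lemma test_funs_fst: "smooth_periodic h \<Longrightarrow> (\<lambda>z. h (fst z)) \<in> test_funs"
  by (auto simp: test_funs_def smooth_periodic_def intro: C_infinity_compose_linear bounded_linear_fst)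

lemma test_funs_snd: "smooth_periodic h \<Longrightarrow> (\<lambda>z. h (snd z)) \<in> test_funs"
  by (auto simp: test_funs_def smooth_periodic_def intro: C_infinity_compose_linear bounded_linear_snd)

lemma test_funs_dir_deriv: "\<phi> \<in> test_funs \<Longrightarrow> dir_deriv v \<phi> \<in> test_funs"
  by (rule test_funsI)
    (auto intro!: dir_deriv_shift simp: test_funs_differentiable test_fun_periodic C_infinityD test_funs_smooth
      simp del: add_Pair)

lemma test_funs_dir_deriv_pow: "\<phi> \<in> test_funs \<Longrightarrow> (dir_deriv v ^^ n) \<phi> \<in> test_funs"
  by (induction n) (auto intro: test_funs_dir_deriv)

lemma test_funs_partial_deriv: "\<phi> \<in> test_funs \<Longrightarrow> partial_deriv a b \<phi> \<in> test_funs"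
  unfolding partial_deriv_def by (intro test_funs_dir_deriv_pow)

text \<open>Compactness of a period square. Every estimate of a seminorm rests on this, since a real
  \<open>SUP\<close> bounds its terms only when the family is bounded above.\<close>

lemma test_funs_bounded:
  assumes "\<phi> \<in> test_funs"
  shows "bdd_above (range (\<lambda>z. cmod (\<phi> z)))"
proof -
  have "compact (\<phi> ` ({0..2 * pi} \<times> {0..2 * pi}))"
    using assms by (intro compact_continuous_image C_infinityD test_funs_smooth compact_Times) auto
  then obtain B where B: "\<And>z. z \<in> {0..2 * pi} \<times> {0..2 * pi} \<Longrightarrow> cmod (\<phi> z) \<le> B"
    using compact_imp_bounded bounded_iff by (metis imageI)
  have "cmod (\<phi> (t, x)) \<le> B" for t x
  proof -
    obtain n where n: "t + of_int n * (2 * pi) \<in> {0..2 * pi}" by (rule reduce_to_period)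
    obtain m where m: "x + of_int m * (2 * pi) \<in> {0..2 * pi}" by (rule reduce_to_period)
    have "\<phi> (t + of_int n * (2 * pi), x + of_int m * (2 * pi)) = \<phi> (t, x)"
      using periodic_plus_int[of "\<lambda>t. \<phi> (t, x + of_int m * (2 * pi))" "2 * pi" t n]
        periodic_plus_int[of "\<lambda>x. \<phi> (t, x)" "2 * pi" x m] assms
      by (simp add: test_funs_def)
    then show ?thesis using B[of "(t + of_int n * (2 * pi), x + of_int m * (2 * pi))"] n m by simp
  qed
  then show ?thesis by (auto intro!: bdd_aboveI[of _ B])
qed

abbreviation sup_cmod :: "(real \<times> real \<Rightarrow> complex) \<Rightarrow> real" where
  "sup_cmod \<phi> \<equiv> (SUP z. cmod (\<phi> z))"

lemma cmod_le_sup_cmod: "\<phi> \<in> test_funs \<Longrightarrow> cmod (\<phi> z) \<le> sup_cmod \<phi>"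
  by (intro cSUP_upper test_funs_bounded) auto

lemma sup_cmod_nonneg: "\<phi> \<in> test_funs \<Longrightarrow> 0 \<le> sup_cmod \<phi>"
  by (rule order_trans[OF norm_ge_zero cmod_le_sup_cmod])

lemma finite_order_le: "finite {(a, b). a + b \<le> (N :: nat)}"
  by (rule finite_subset[of _ "{..N} \<times> {..N}"]) auto

lemma sup_cmod_le_test_seminorm:
  assumes "\<phi> \<in> test_funs" "a + b \<le> N"
  shows "sup_cmod (partial_deriv a b \<phi>) \<le> test_seminorm N \<phi>"
  unfolding test_seminorm_def
  using assms
  by (intro member_le_sum[of "(a, b)" _ "\<lambda>(a, b). sup_cmod (partial_deriv a b \<phi>)", simplified prod.case])
    (auto simp: finite_order_le intro!: sup_cmod_nonneg test_funs_partial_deriv)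

lemma test_seminorm_nonneg: "\<phi> \<in> test_funs \<Longrightarrow> 0 \<le> test_seminorm N \<phi>"
  unfolding test_seminorm_def by (auto intro!: sum_nonneg sup_cmod_nonneg test_funs_partial_deriv)

lemma test_seminorm_mono: "\<phi> \<in> test_funs \<Longrightarrow> M \<le> N \<Longrightarrow> test_seminorm M \<phi> \<le> test_seminorm N \<phi>"
  unfolding test_seminorm_def
  by (intro sum_mono2 finite_order_le) (auto intro!: sup_cmod_nonneg test_funs_partial_deriv)

lemma dir_deriv_slice_fst:
  assumes "\<phi> \<in> test_funs"
  shows "((\<lambda>t. \<phi> (t, x)) has_vector_derivative dir_deriv (1, 0) \<phi> (t, x)) (at t)"
proof -
  have d: "(\<phi> has_derivative (\<lambda>v. dir_deriv v \<phi> (t, x))) (at (t, x))"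
    by (intro has_derivative_dir_deriv test_funs_differentiable assms)
  then have "((\<lambda>t. \<phi> (t, x)) has_derivative (\<lambda>s. dir_deriv (s, 0) \<phi> (t, x))) (at t)"
    by (intro has_derivative_compose[of "\<lambda>t. (t, x)" "\<lambda>s. (s, 0)", OF _ d])
      (auto intro!: derivative_eq_intros)
  moreover have "dir_deriv (s, 0) \<phi> (t, x) = s *\<^sub>R dir_deriv (1, 0) \<phi> (t, x)" for s
    using linear_cmul[OF has_derivative_linear[OF d], of s "(1, 0)"]
    by (simp only: scaleR_Pair real_scaleR_def mult_1_right mult_zero_right)
  then have "(\<lambda>s. dir_deriv (s, 0) \<phi> (t, x)) = (\<lambda>s. s *\<^sub>R dir_deriv (1, 0) \<phi> (t, x))"
    by (rule ext)
  ultimately show ?thesis by (simp only: has_vector_derivative_def)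
qed

lemma dir_deriv_slice_snd:
  assumes "\<phi> \<in> test_funs"
  shows "((\<lambda>x. \<phi> (t, x)) has_vector_derivative dir_deriv (0, 1) \<phi> (t, x)) (at x)"
proof -
  have d: "(\<phi> has_derivative (\<lambda>v. dir_deriv v \<phi> (t, x))) (at (t, x))"
    by (intro has_derivative_dir_deriv test_funs_differentiable assms)
  then have "((\<lambda>x. \<phi> (t, x)) has_derivative (\<lambda>s. dir_deriv (0, s) \<phi> (t, x))) (at x)"
    by (intro has_derivative_compose[of "\<lambda>x. (t, x)" "\<lambda>s. (0, s)", OF _ d])
      (auto intro!: derivative_eq_intros)
  moreover have "dir_deriv (0, s) \<phi> (t, x) = s *\<^sub>R dir_deriv (0, 1) \<phi> (t, x)" for s
    using linear_cmul[OF has_derivative_linear[OF d], of s "(0, 1)"]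
    by (simp only: scaleR_Pair real_scaleR_def mult_1_right mult_zero_right)
  then have "(\<lambda>s. dir_deriv (0, s) \<phi> (t, x)) = (\<lambda>s. s *\<^sub>R dir_deriv (0, 1) \<phi> (t, x))"
    by (rule ext)
  ultimately show ?thesis by (simp only: has_vector_derivative_def)
qed

text \<open>Proved by differentiating \<open>\<phi> (t, x) = \<phi> (t, x\<^sub>0 - 1) + \<integral> \<partial>\<^sub>x \<phi>\<close> under the integral sign.\<close>

lemma dir_deriv_commute:
  assumes \<phi>: "\<phi> \<in> test_funs"
  shows "dir_deriv (0, 1) (dir_deriv (1, 0) \<phi>) = dir_deriv (1, 0) (dir_deriv (0, 1) \<phi>)"
proof
  fix z :: "real \<times> real"
  obtain t0 x0 where z: "z = (t0, x0)" by (cases z)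
  let ?Dt = "dir_deriv (1, 0) :: _ \<Rightarrow> _ \<Rightarrow> complex" and ?Dx = "dir_deriv (0, 1) :: _ \<Rightarrow> _ \<Rightarrow> complex"
  let ?I = "{x0 - 1..x0 + 1}"
  have c: "continuous_on S (\<lambda>w. ?Dt (?Dx \<phi>) (f w))" "continuous_on S (\<lambda>w. ?Dx \<phi> (f w))"
    if "continuous_on S f" for S and f :: "'c::topological_space \<Rightarrow> _"
    using that assms
    by (auto intro!: continuous_on_compose2[of UNIV _ _ f] C_infinityD test_funs_smooth test_funs_dir_deriv)
  have eq: "?Dt \<phi> (t0, x) = ?Dt \<phi> (t0, x0 - 1) + integral {x0 - 1..x} (\<lambda>y. ?Dt (?Dx \<phi>) (t0, y))"
    if "x \<in> ?I" for x
  proof -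
    have ftc: "((\<lambda>y. ?Dx \<phi> (t, y)) has_integral \<phi> (t, x) - \<phi> (t, x0 - 1)) {x0 - 1..x}" for t
      using that
      by (intro fundamental_theorem_of_calculus has_vector_derivative_at_within[OF dir_deriv_slice_snd] \<phi>) auto
    have "((\<lambda>t. integral (cbox (x0 - 1) x) (\<lambda>y. ?Dx \<phi> (t, y))) has_vector_derivative
        integral (cbox (x0 - 1) x) (\<lambda>y. ?Dt (?Dx \<phi>) (t0, y))) (at t0 within UNIV)"
      using \<phi>
      by (intro leibniz_rule_vector_derivative)
        (auto intro!: dir_deriv_slice_fst test_funs_dir_deriv integrable_continuous_interval continuous_intros c
          simp: case_prod_unfold)
    moreover have "((\<lambda>t. \<phi> (t, x) - \<phi> (t, x0 - 1)) has_vector_derivative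
        ?Dt \<phi> (t0, x) - ?Dt \<phi> (t0, x0 - 1)) (at t0)"
      by (intro has_vector_derivative_diff dir_deriv_slice_fst \<phi>)
    moreover have "integral (cbox (x0 - 1) x) (\<lambda>y. ?Dx \<phi> (t, y)) = \<phi> (t, x) - \<phi> (t, x0 - 1)" for t
      using integral_unique[OF ftc] by simp
    ultimately show ?thesis
      using vector_derivative_unique_at[of "\<lambda>t. \<phi> (t, x) - \<phi> (t, x0 - 1)"] by fastforce
  qed
  have "((\<lambda>x. integral {x0 - 1..x} (\<lambda>y. ?Dt (?Dx \<phi>) (t0, y))) has_vector_derivative
      ?Dt (?Dx \<phi>) (t0, x0)) (at x0 within ?I)"
    by (intro integral_has_vector_derivative c continuous_intros) auto
  then have "((\<lambda>x. ?Dt \<phi> (t0, x0 - 1) + integral {x0 - 1..x} (\<lambda>y. ?Dt (?Dx \<phi>) (t0, y)))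
      has_vector_derivative 0 + ?Dt (?Dx \<phi>) (t0, x0)) (at x0 within ?I)"
    by (intro has_vector_derivative_add has_vector_derivative_const)
  then have "((\<lambda>x. ?Dt \<phi> (t0, x)) has_vector_derivative 0 + ?Dt (?Dx \<phi>) (t0, x0)) (at x0 within ?I)"
    by (rule has_vector_derivative_transform[rotated 2]) (auto intro: eq)
  \<comment> \<open>The base point \<open>x0 - 1\<close> was chosen to the left of \<open>x0\<close>
    so that \<open>x0\<close> is interior and the one-sided restriction disappears.\<close>
  moreover have "at x0 within ?I = at x0"
    by (rule at_within_interior) simp
  ultimately have "((\<lambda>x. ?Dt \<phi> (t0, x)) has_vector_derivative ?Dt (?Dx \<phi>) (t0, x0)) (at x0)"
    by simp
  with dir_deriv_slice_snd[OF test_funs_dir_deriv[OF \<phi>]]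
  show "?Dx (?Dt \<phi>) z = ?Dt (?Dx \<phi>) z"
    unfolding z by (rule vector_derivative_unique_at)
qed

text \<open>\<open>partial_deriv\<close> takes the \<open>x\<close>-derivatives innermost, so a
  further innermost \<open>t\<close>-derivative must be carried through them; this is where the
  symmetry of mixed derivatives enters.\<close>

lemma partial_deriv_dir_deriv_fst:
  assumes "\<phi> \<in> test_funs"
  shows "partial_deriv a b (dir_deriv (1, 0) \<phi>) = partial_deriv (Suc a) b \<phi>"
proof -
  have "(dir_deriv (0, 1) ^^ b) (dir_deriv (1, 0) \<phi>) = dir_deriv (1, 0) ((dir_deriv (0, 1) ^^ b) \<phi>)"
    by (induction b) (auto simp: dir_deriv_commute test_funs_dir_deriv_pow assms)
  then show ?thesis by (simp add: partial_deriv_def funpow_swap1)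
qed

lemma partial_deriv_dir_deriv_snd:
  "partial_deriv a b (dir_deriv (0, 1) \<phi>) = partial_deriv a (Suc b) \<phi>"
  by (simp add: partial_deriv_def funpow_swap1)

text \<open>Differentiation shifts the multi-indices injectively into those of order at most
  \<open>Suc N\<close>, and the terms missed by the shift are nonnegative. Hence the constant is
  1.\<close>

lemma test_seminorm_dir_deriv:
  assumes "\<phi> \<in> test_funs" "v = (1, 0) \<or> v = (0, 1)"
  shows "test_seminorm N (dir_deriv v \<phi>) \<le> test_seminorm (Suc N) \<phi>"
proof -
  define f :: "nat \<times> nat \<Rightarrow> nat \<times> nat" where
    "f = (if v = (1, 0) then map_prod Suc id else map_prod id Suc)"
  have inj: "inj_on f S" for S by (auto simp: f_def inj_on_def)
  have f: "partial_deriv a b (dir_deriv v \<phi>) = (\<lambda>(a, b). partial_deriv a b \<phi>) (f (a, b))" for a b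
    using assms by (auto simp: f_def partial_deriv_dir_deriv_fst partial_deriv_dir_deriv_snd)
  have "test_seminorm N (dir_deriv v \<phi>)
      = (\<Sum>p\<in>{(a, b). a + b \<le> N}. (\<lambda>(a, b). sup_cmod (partial_deriv a b \<phi>)) (f p))"
    unfolding test_seminorm_def f by (simp add: case_prod_unfold)
  also have "\<dots> = (\<Sum>p\<in>f ` {(a, b). a + b \<le> N}. (\<lambda>(a, b). sup_cmod (partial_deriv a b \<phi>)) p)"
    by (simp only: sum.reindex[OF inj] o_def)
  also have "\<dots> \<le> test_seminorm (Suc N) \<phi>"
    unfolding test_seminorm_def using assms(1)
    by (intro sum_mono2 finite_order_le)
      (auto simp: f_def intro!: sup_cmod_nonneg test_funs_partial_deriv split: if_splits)
  finally show ?thesis .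
qed

section \<open>The shear inverse to the map in \<open>Psi A\<close>, and its effect on the
  seminorms\<close>

definition shear :: "(real \<Rightarrow> real) \<Rightarrow> real \<times> real \<Rightarrow> real \<times> real" where
  "shear A z = (fst z, snd z + A (fst z))"

text \<open>The derivative is written as the identity plus a multiple of \<open>(0, 1)\<close>, so
  that linearity splits the chain rule into the old direction and an
  \<open>x\<close>-derivative.\<close>

lemma has_derivative_shear:
  assumes "C_infinity A"
  shows "(shear A has_derivative (\<lambda>v. v + (fst v * dir_deriv 1 A (fst z)) *\<^sub>R (0, 1))) (at z)"
proof -
  have A: "(A has_derivative (\<lambda>h. h * dir_deriv 1 A (fst z))) (at (fst z))"
    using has_vector_derivative_dir_deriv[of A "fst z"] assms
    by (simp add: has_vector_derivative_def C_infinityD)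
  have "((\<lambda>z. (fst z, snd z + A (fst z))) has_derivative
      (\<lambda>v. (fst v, snd v + fst v * dir_deriv 1 A (fst z)))) (at z)"
    by (rule derivative_eq_intros has_derivative_compose[of fst fst, OF _ A] | simp)+
  also have "(\<lambda>z. (fst z, snd z + A (fst z))) = shear A" by (auto simp: shear_def)
  also have "(\<lambda>v. (fst v, snd v + fst v * dir_deriv 1 A (fst z))) =
      (\<lambda>v. v + (fst v * dir_deriv 1 A (fst z)) *\<^sub>R (0, 1))" by auto
  finally show ?thesis .
qed

lemma has_derivative_compose_shear:
  assumes "C_infinity A" "\<phi> differentiable (at (shear A z))"
  shows "((\<lambda>z. \<phi> (shear A z)) has_derivative
     (\<lambda>v. dir_deriv v \<phi> (shear A z)
        + (fst v * dir_deriv 1 A (fst z)) *\<^sub>R dir_deriv (0, 1) \<phi> (shear A z))) (at z)"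
proof -
  note d = has_derivative_dir_deriv[OF assms(2)]
  show ?thesis
    using has_derivative_compose[OF has_derivative_shear[OF assms(1)] d]
    unfolding linear_add[OF has_derivative_linear[OF d]] linear_cmul[OF has_derivative_linear[OF d]] .
qed

lemma dir_deriv_compose_shear:
  fixes \<phi> :: "real \<times> real \<Rightarrow> complex"
  assumes "C_infinity A" "\<And>z. \<phi> differentiable (at z)"
  shows "dir_deriv v (\<lambda>z. \<phi> (shear A z)) = (\<lambda>z. dir_deriv v \<phi> (shear A z)
     + (complex_of_real (fst v) * complex_of_real (dir_deriv 1 A (fst z))) * dir_deriv (0, 1) \<phi> (shear A z))"
  by (rule ext, subst dir_deriv_eqI[OF has_derivative_compose_shear[OF assms]])
    (simp add: scaleR_conv_of_real)

text \<open>The derivative of a composition with the shear is a combination, with smooth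
  coefficients, of derivatives of \<phi> composed with the same shear. The induction therefore runs
  over all \<phi> at once.\<close>

lemma C_k_compose_shear:
  fixes \<phi> :: "real \<times> real \<Rightarrow> complex"
  assumes A: "C_infinity A"
  shows "C_k k \<phi> \<Longrightarrow> C_k k (\<lambda>z. \<phi> (shear A z))"
proof (induction k arbitrary: \<phi>)
  case 0
  have "continuous_on UNIV (shear A)"
    by (intro continuous_at_imp_continuous_on ballI has_derivative_continuous[OF has_derivative_shear[OF A]])
  with 0 show ?case by (auto intro: continuous_on_compose2[of UNIV \<phi>])
next
  case (Suc k)
  have d: "\<phi> differentiable (at z)" for z using Suc.prems by (simp del: split_paired_All)
  have "C_infinity (\<lambda>z. complex_of_real (dir_deriv 1 A (fst (z :: real \<times> real))))"
    by (intro C_infinity_linear_compose[OF bounded_linear_of_real]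
        C_infinity_compose_linear[OF bounded_linear_fst] C_infinityD A)
  then have "C_k k (\<lambda>z. complex_of_real (dir_deriv 1 A (fst (z :: real \<times> real))))"
    by (simp add: C_infinity_def)
  moreover have "C_k k (\<lambda>z. dir_deriv v \<phi> (shear A z))" for v
    using Suc.IH[of "dir_deriv v \<phi>"] Suc.prems by (simp del: split_paired_All)
  ultimately have "C_k k (dir_deriv v (\<lambda>z. \<phi> (shear A z)))" for v
    unfolding dir_deriv_compose_shear[OF A d] by (intro C_k_add C_k_mult C_k_const)
  moreover have "(\<lambda>z. \<phi> (shear A z)) differentiable (at z)" for z
    using has_derivative_compose_shear[OF A d] unfolding differentiable_def by blast
  ultimately show ?case by simp
qed

lemma test_funs_shear:
  assumes "smooth_circle_fun A" "\<phi> \<in> test_funs"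
  shows "(\<lambda>z. \<phi> (shear A z)) \<in> test_funs"
proof (rule test_funsI)
  show "C_infinity (\<lambda>z. \<phi> (shear A z))"
    using assms C_k_compose_shear[of A _ \<phi>] by (auto simp: C_infinity_def smooth_circle_fun_def test_funs_def)
  show "\<phi> (shear A (z + (2 * pi, 0))) = \<phi> (shear A z)" "\<phi> (shear A (z + (0, 2 * pi))) = \<phi> (shear A z)" for z
    using assms test_fun_periodic[of \<phi> "shear A z"]
    by (auto simp: shear_def smooth_circle_fun_def plus_prod_def algebra_simps)
qed

lemma dir_deriv_pow_add:
  assumes "\<phi> \<in> test_funs" "\<psi> \<in> test_funs"
  shows "(dir_deriv v ^^ n) (\<lambda>z. \<phi> z + \<psi> z) = (\<lambda>z. (dir_deriv v ^^ n) \<phi> z + (dir_deriv v ^^ n) \<psi> z)"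
  by (induction n) (auto simp: dir_deriv_add test_funs_differentiable test_funs_dir_deriv_pow assms)

text \<open>Products of a coefficient in \<open>t\<close> with a sheared test function are closed,
  up to sums, under the \<open>t\<close>-derivative. The new coefficients are \<open>c\<close>,
  \<open>c\<close> times the derivative of \<open>A\<close>, and the derivative of
  \<open>c\<close>.\<close>

lemma dir_deriv_fst_mult_shear:
  assumes A: "smooth_circle_fun A" and c: "smooth_periodic c" and \<phi>: "\<phi> \<in> test_funs"
  shows "dir_deriv (1, 0) (\<lambda>z. c (fst z) * \<phi> (shear A z)) =
     (\<lambda>z. (c (fst z) * dir_deriv (1, 0) \<phi> (shear A z)
        + (c (fst z) * complex_of_real (dir_deriv 1 A (fst z))) * dir_deriv (0, 1) \<phi> (shear A z))
        + dir_deriv 1 c (fst z) * \<phi> (shear A z))"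
proof -
  have cf: "((\<lambda>z. c (fst z)) has_derivative (\<lambda>v. fst v *\<^sub>R dir_deriv 1 c (fst z))) (at z)" for z :: "real \<times> real"
    using smooth_periodicD(2)[OF c, of "fst z"]
    by (intro has_derivative_compose[of fst fst _ _ c]) (auto simp: has_vector_derivative_def intro!: derivative_eq_intros)
  have "dir_deriv (1, 0) (\<lambda>z. c (fst z)) = (\<lambda>z. dir_deriv 1 c (fst (z :: real \<times> real)))"
    by (rule ext, subst dir_deriv_eqI[OF cf]) simp
  moreover have "(\<lambda>z. c (fst z)) differentiable at z" for z :: "real \<times> real"
    using cf unfolding differentiable_def by blast
  ultimately show ?thesis
    using A test_funs_differentiable[OF \<phi>]
    by (subst dir_deriv_mult)
      (auto simp: dir_deriv_compose_shear smooth_circle_fun_def algebra_simps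
        intro!: test_funs_differentiable test_funs_shear \<phi> A)
qed

text \<open>Only \<open>c = 1\<close> is wanted in the end; the arbitrary coefficient is there for
  the induction, since each \<open>t\<close>-derivative creates new ones.\<close>

lemma dir_deriv_pow_shear_bound:
  assumes A: "smooth_circle_fun A"
  shows "smooth_periodic c \<Longrightarrow> \<exists>C\<ge>0. \<forall>\<phi>\<in>test_funs. \<forall>z.
     cmod ((dir_deriv (1, 0) ^^ a) (\<lambda>z. c (fst z) * \<phi> (shear A z)) z) \<le> C * test_seminorm a \<phi>"
proof (induction a arbitrary: c)
  case 0
  then obtain B where B: "B \<ge> 0" "\<And>t. cmod (c t) \<le> B" using smooth_periodic_bounded by blast
  show ?case
  proof (intro exI[of _ B] conjI ballI allI B)
    fix \<phi> :: "real \<times> real \<Rightarrow> complex" and z assume \<phi>: "\<phi> \<in> test_funs"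
    have "cmod (\<phi> (shear A z)) \<le> test_seminorm 0 \<phi>"
      using order_trans[OF cmod_le_sup_cmod sup_cmod_le_test_seminorm[of \<phi> 0 0 0]] \<phi>
      by (simp add: partial_deriv_def)
    then show "cmod ((dir_deriv (1, 0) ^^ 0) (\<lambda>z. c (fst z) * \<phi> (shear A z)) z) \<le> B * test_seminorm 0 \<phi>"
      using B by (auto simp: norm_mult intro!: mult_mono)
  qed
next
  case (Suc a)
  let ?c2 = "\<lambda>t. c t * complex_of_real (dir_deriv 1 A t)" and ?c3 = "dir_deriv 1 c"
  have c: "smooth_periodic ?c2" "smooth_periodic ?c3"
    using Suc.prems A
    by (auto intro!: smooth_periodic_mult smooth_periodic_of_real smooth_circle_fun_deriv smooth_periodicD)
  let ?D = "\<lambda>c \<phi>. (dir_deriv (1, 0) ^^ a) (\<lambda>z. c (fst z) * \<phi> (shear A z))"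
  obtain C1 where "C1 \<ge> 0" and C1: "\<forall>\<phi>\<in>test_funs. \<forall>z. cmod (?D c \<phi> z) \<le> C1 * test_seminorm a \<phi>"
    using Suc.IH[OF Suc.prems] by (elim exE conjE)
  obtain C2 where "C2 \<ge> 0" and C2: "\<forall>\<phi>\<in>test_funs. \<forall>z. cmod (?D ?c2 \<phi> z) \<le> C2 * test_seminorm a \<phi>"
    using Suc.IH[OF c(1)] by (elim exE conjE)
  obtain C3 where "C3 \<ge> 0" and C3: "\<forall>\<phi>\<in>test_funs. \<forall>z. cmod (?D ?c3 \<phi> z) \<le> C3 * test_seminorm a \<phi>"
    using Suc.IH[OF c(2)] by (elim exE conjE)
  note C = \<open>C1 \<ge> 0\<close> \<open>C2 \<ge> 0\<close> \<open>C3 \<ge> 0\<close>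
  show ?case
  proof (intro exI[of _ "C1 + C2 + C3"] conjI ballI allI)
    fix \<phi> :: "real \<times> real \<Rightarrow> complex" and z assume \<phi>: "\<phi> \<in> test_funs"
    note d = test_funs_dir_deriv[OF \<phi>]
    have t: "(\<lambda>z. c (fst z) * \<phi> (shear A z)) \<in> test_funs"
      if "smooth_periodic c" "\<phi> \<in> test_funs" for c \<phi>
      by (intro test_funs_mult test_funs_fst test_funs_shear that A)
    \<comment> \<open>The extra derivative is taken innermost, so that the induction hypothesis
      applies to the three resulting products, each with its own coefficient and test
      function.\<close>
    have eq: "(dir_deriv (1, 0) ^^ Suc a) (\<lambda>z. c (fst z) * \<phi> (shear A z)) z
        = ?D c (dir_deriv (1, 0) \<phi>) z + ?D ?c2 (dir_deriv (0, 1) \<phi>) z + ?D ?c3 \<phi> z"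
      unfolding funpow_Suc_right o_apply dir_deriv_fst_mult_shear[OF A Suc.prems \<phi>]
      by (subst dir_deriv_pow_add, intro test_funs_add t Suc.prems c d, intro t c \<phi>,
          subst dir_deriv_pow_add, intro t Suc.prems d, intro t c d, rule refl)
    have "cmod ((dir_deriv (1, 0) ^^ Suc a) (\<lambda>z. c (fst z) * \<phi> (shear A z)) z) \<le> C1 * test_seminorm a (dir_deriv (1, 0) \<phi>)
        + C2 * test_seminorm a (dir_deriv (0, 1) \<phi>) + C3 * test_seminorm a \<phi>"
      unfolding eq by (intro norm_triangle_le add_mono C1[rule_format] C2[rule_format] C3[rule_format] d \<phi>)
    also have "\<dots> \<le> C1 * test_seminorm (Suc a) \<phi> + C2 * test_seminorm (Suc a) \<phi> + C3 * test_seminorm (Suc a) \<phi>"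
      by (intro add_mono mult_left_mono C test_seminorm_dir_deriv[OF \<phi> disjI1[OF refl]]
          test_seminorm_dir_deriv[OF \<phi> disjI2[OF refl]] test_seminorm_mono[OF \<phi> le_SucI[OF order_refl]])
    finally show "cmod ((dir_deriv (1, 0) ^^ Suc a) (\<lambda>z. c (fst z) * \<phi> (shear A z)) z)
        \<le> (C1 + C2 + C3) * test_seminorm (Suc a) \<phi>"
      by (simp add: algebra_simps)
  qed (use C in simp)
qed

lemma test_seminorm_dir_deriv_snd_pow:
  "\<phi> \<in> test_funs \<Longrightarrow> test_seminorm a ((dir_deriv (0, 1) ^^ b) \<phi>) \<le> test_seminorm (a + b) \<phi>"
proof (induction b arbitrary: \<phi>)
  case (Suc b)
  have "test_seminorm a ((dir_deriv (0, 1) ^^ b) (dir_deriv (0, 1) \<phi>))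
      \<le> test_seminorm (a + b) (dir_deriv (0, 1) \<phi>)"
    by (intro Suc.IH test_funs_dir_deriv Suc.prems)
  also have "\<dots> \<le> test_seminorm (Suc (a + b)) \<phi>"
    by (intro test_seminorm_dir_deriv Suc.prems) auto
  finally show ?case by (simp add: funpow_swap1)
qed simp

text \<open>Derivatives in \<open>x\<close> commute with the shear exactly, because the correction
  term carries the factor \<open>fst (0, 1) = 0\<close>. Only the \<open>t\<close>-derivatives cost
  a constant, and the order \<open>N\<close> does not increase.\<close>

lemma test_seminorm_shear:
  assumes A: "smooth_circle_fun A"
  obtains C where "C \<ge> 0"
    "\<And>\<phi>. \<phi> \<in> test_funs \<Longrightarrow> test_seminorm N (\<lambda>z. \<phi> (shear A z)) \<le> C * test_seminorm N \<phi>"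
proof -
  have "\<forall>a. \<exists>C\<ge>0. \<forall>\<phi>\<in>test_funs. \<forall>z.
      cmod ((dir_deriv (1, 0) ^^ a) (\<lambda>z. \<phi> (shear A z)) z) \<le> C * test_seminorm a \<phi>"
    using dir_deriv_pow_shear_bound[OF A smooth_periodic_const[of 1]] by simp
  then obtain C where C: "\<And>a. C a \<ge> 0"
    "\<And>a \<phi> z. \<phi> \<in> test_funs \<Longrightarrow> cmod ((dir_deriv (1, 0) ^^ a) (\<lambda>z. \<phi> (shear A z)) z) \<le> C a * test_seminorm a \<phi>"
    unfolding choice_iff by (elim exE) blast
  have "sup_cmod (partial_deriv a b (\<lambda>z. \<phi> (shear A z))) \<le> C a * test_seminorm N \<phi>"
    if \<phi>: "\<phi> \<in> test_funs" and ab: "a + b \<le> N" for \<phi> a b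
  proof (intro cSUP_least)
    fix z
    have "(dir_deriv (0, 1) ^^ b) (\<lambda>z. \<phi> (shear A z)) = (\<lambda>z. (dir_deriv (0, 1) ^^ b) \<phi> (shear A z))"
    proof (induction b)
      case (Suc b)
      then show ?case
        using A \<phi> by (simp add: dir_deriv_compose_shear smooth_circle_fun_def test_funs_differentiable
            test_funs_dir_deriv_pow)
    qed simp
    then have "cmod (partial_deriv a b (\<lambda>z. \<phi> (shear A z)) z) \<le> C a * test_seminorm a ((dir_deriv (0, 1) ^^ b) \<phi>)"
      unfolding partial_deriv_def using C(2)[OF test_funs_dir_deriv_pow[OF \<phi>]] by simp
    also have "\<dots> \<le> C a * test_seminorm N \<phi>"
      by (intro mult_left_mono C order_trans[OF test_seminorm_dir_deriv_snd_pow test_seminorm_mono] \<phi> ab)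
    finally show "cmod (partial_deriv a b (\<lambda>z. \<phi> (shear A z)) z) \<le> C a * test_seminorm N \<phi>" .
  qed simp
  then have "test_seminorm N (\<lambda>z. \<phi> (shear A z)) \<le> (\<Sum>(a, b)\<in>{(a, b). a + b \<le> N}. C a) * test_seminorm N \<phi>"
    if "\<phi> \<in> test_funs" for \<phi>
    unfolding test_seminorm_def[of N "\<lambda>z. \<phi> (shear A z)"] sum_distrib_right
    using that by (intro sum_mono) auto
  moreover have "(\<Sum>(a, b)\<in>{(a, b). a + b \<le> N}. C a) \<ge> 0"
    using C by (auto intro!: sum_nonneg)
  ultimately show ?thesis using that by blast
qed

section \<open>Fourier series on the circle\<close>

definition circle_mean :: "(real \<Rightarrow> complex) \<Rightarrow> complex" where
  "circle_mean f = integral {0..2 * pi} f / complex_of_real (2 * pi)"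

text \<open>With this sign it is the coefficient of the mode \<open>cis (- of_int n * t)\<close>.
  These are the modes at which \<open>fourier_coeff\<close> evaluates a distribution, so an
  expansion in them can be paired with \<open>u\<close> term by term.\<close>

definition fcoef :: "(real \<Rightarrow> complex) \<Rightarrow> int \<Rightarrow> complex" where
  "fcoef f n = circle_mean (\<lambda>t. f t * cis (of_int n * t))"

lemma Re_mult_cnj: "Re (z * cnj z) = (cmod z)\<^sup>2"
  by (simp add: complex_norm_square[symmetric] del: of_real_power)

lemma Re_of_real_mult: "Re (of_real x * z) = x * Re z"
  by simp

lemma circle_mean_add:
  assumes "continuous_on {0..2 * pi} f" "continuous_on {0..2 * pi} g"
  shows "circle_mean (\<lambda>t. f t + g t) = circle_mean f + circle_mean g"
  using assms unfolding circle_mean_def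
  by (subst integral_add) (auto intro: integrable_continuous_interval simp: add_divide_distrib)

lemma circle_mean_cmult: "circle_mean (\<lambda>t. c * f t) = c * circle_mean f"
  by (simp add: circle_mean_def)

lemma circle_mean_diff:
  assumes "continuous_on {0..2 * pi} f" "continuous_on {0..2 * pi} g"
  shows "circle_mean (\<lambda>t. f t - g t) = circle_mean f - circle_mean g"
  using assms unfolding circle_mean_def
  by (subst integral_diff) (auto intro: integrable_continuous_interval simp: diff_divide_distrib)

lemma circle_mean_sum:
  assumes "finite I" "\<And>i. i \<in> I \<Longrightarrow> continuous_on {0..2 * pi} (f i)"
  shows "circle_mean (\<lambda>t. \<Sum>i\<in>I. f i t) = (\<Sum>i\<in>I. circle_mean (f i))"
  using assms unfolding circle_mean_def
  by (subst integral_sum) (auto intro: integrable_continuous_interval simp: sum_divide_distrib)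

lemma circle_mean_cnj:
  assumes "continuous_on {0..2 * pi} f"
  shows "circle_mean (\<lambda>t. cnj (f t)) = cnj (circle_mean f)"
  using integral_linear[OF integrable_continuous_interval[OF assms] bounded_linear_cnj]
  by (simp add: circle_mean_def o_def)

lemma Re_circle_mean_mono:
  assumes "continuous_on {0..2 * pi} f" "continuous_on {0..2 * pi} g"
    and "\<And>t. Re (f t) \<le> Re (g t)"
  shows "Re (circle_mean f) \<le> Re (circle_mean g)"
proof -
  have *: "Re (circle_mean h) = integral {0..2 * pi} (\<lambda>t. Re (h t)) / (2 * pi)"
    if "continuous_on {0..2 * pi} h" for h
    using integral_linear[OF integrable_continuous_interval[OF that] bounded_linear_Re]
    by (simp add: circle_mean_def o_def Re_divide_of_real del: of_real_mult)
  show ?thesis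
    unfolding *[OF assms(1)] *[OF assms(2)]
    by (intro divide_right_mono integral_le integrable_continuous_interval continuous_intros assms) auto
qed

lemma norm_circle_mean_le:
  assumes "continuous_on {0..2 * pi} f" "\<And>t. cmod (f t) \<le> B"
  shows "cmod (circle_mean f) \<le> B"
proof -
  have "cmod (integral {0..2 * pi} f) \<le> B * (2 * pi - 0)"
    by (rule integral_bound) (use assms in auto)
  then show ?thesis by (simp add: circle_mean_def norm_divide divide_simps norm_mult)
qed

lemma circle_mean_deriv:
  assumes "\<And>t. (f has_vector_derivative f' t) (at t)" "f (2 * pi) = f 0"
  shows "circle_mean f' = 0"
proof -
  have "(f' has_integral f (2 * pi) - f 0) {0..2 * pi}"
    by (intro fundamental_theorem_of_calculus has_vector_derivative_at_within[OF assms(1)]) simp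
  then show ?thesis using assms(2) by (simp add: circle_mean_def integral_unique)
qed

lemma has_vector_derivative_cis:
  "((\<lambda>t. cis (a * t)) has_vector_derivative \<i> * of_real a * cis (a * t)) (at t)"
  unfolding has_vector_derivative_def
  by (rule derivative_eq_intros refl | simp add: scaleR_conv_of_real mult_ac)+

lemma cis_int_2pi: "cis (of_int n * (2 * pi)) = 1"
  using cis_multiple_2pi[of "of_int n"] by (simp add: mult_ac)

lemma circle_mean_cis: "circle_mean (\<lambda>t. cis (of_int n * t)) = (if n = 0 then 1 else 0)"
proof (cases "n = 0")
  case False
  have "circle_mean (\<lambda>t. (\<i> * of_real (of_int n)) * cis (of_int n * t)) = 0"
    by (rule circle_mean_deriv[of "\<lambda>t. cis (of_int n * t)", OF has_vector_derivative_cis])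
      (simp add: cis_int_2pi)
  then show ?thesis using False unfolding circle_mean_cmult by simp
qed (simp add: circle_mean_def scaleR_conv_of_real)

text \<open>Orthonormality of the exponentials. The injection \<open>k\<close> serves two uses with
  opposite signs: modes \<open>- n\<close> in Bessel's inequality, modes \<open>\<sigma>\<close> for
  the input of a Toeplitz matrix.\<close>

lemma circle_mean_parseval:
  assumes "finite I" "inj_on k I"
  shows "circle_mean (\<lambda>t. (\<Sum>i\<in>I. c i * cis (of_int (k i) * t)) * cnj (\<Sum>i\<in>I. c i * cis (of_int (k i) * t)))
    = of_real (\<Sum>i\<in>I. (cmod (c i))\<^sup>2)"
proof -
  have "circle_mean (\<lambda>t. (\<Sum>i\<in>I. c i * cis (of_int (k i) * t)) * cnj (\<Sum>i\<in>I. c i * cis (of_int (k i) * t)))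
      = circle_mean (\<lambda>t. \<Sum>i\<in>I. \<Sum>j\<in>I. (c i * cnj (c j)) * cis (of_int (k i - k j) * t))"
    unfolding cnj_sum sum_product
    by (intro arg_cong[where f = circle_mean] ext sum.cong refl)
      (simp add: cis_cnj cis_mult algebra_simps)
  also have "\<dots> = (\<Sum>i\<in>I. \<Sum>j\<in>I. (c i * cnj (c j)) * (if k i - k j = 0 then 1 else 0))"
    using assms(1) unfolding circle_mean_cis[symmetric]
    by (subst circle_mean_sum, assumption, intro continuous_intros, intro sum.cong refl,
        subst circle_mean_sum, assumption, intro continuous_intros, simp only: circle_mean_cmult)
  also have "\<dots> = (\<Sum>i\<in>I. \<Sum>j\<in>I. if i = j then c i * cnj (c j) else 0)"
    using assms(2) by (intro sum.cong refl) (auto simp: inj_on_def)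
  also have "\<dots> = (\<Sum>i\<in>I. of_real ((cmod (c i))\<^sup>2))"
    using assms(1) by (intro sum.cong refl) (simp add: complex_norm_square del: of_real_power)
  finally show ?thesis by simp
qed

text \<open>The trigonometric polynomial \<open>p\<close> is the orthogonal projection of
  \<open>q\<close>: the means of \<open>p * cnj p\<close>, \<open>q * cnj p\<close> and
  \<open>p * cnj q\<close> all equal \<open>S\<close>, so the nonnegative mean of
  \<open>(q - p) * cnj (q - p)\<close> is that of \<open>q * cnj q\<close> minus
  \<open>S\<close>.\<close>

lemma bessel_inequality:
  assumes q: "continuous_on {0..2 * pi} q" and F: "finite F"
  shows "(\<Sum>n\<in>F. (cmod (fcoef q n))\<^sup>2) \<le> Re (circle_mean (\<lambda>t. q t * cnj (q t)))"
proof -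
  define p where "p t = (\<Sum>n\<in>F. fcoef q n * cis (of_int (- n) * t))" for t
  define S where "S = (\<Sum>n\<in>F. (cmod (fcoef q n))\<^sup>2)"
  have p: "continuous_on {0..2 * pi} p" unfolding p_def by (intro continuous_intros)
  have pp: "circle_mean (\<lambda>t. p t * cnj (p t)) = of_real S"
    unfolding p_def S_def by (rule circle_mean_parseval[OF F]) (auto simp: inj_on_def)
  have "circle_mean (\<lambda>t. q t * cnj (p t))
      = circle_mean (\<lambda>t. \<Sum>n\<in>F. cnj (fcoef q n) * (q t * cis (of_int n * t)))"
    unfolding p_def cnj_sum sum_distrib_left
    by (intro arg_cong[where f = circle_mean] ext sum.cong refl) (simp add: cis_cnj mult_ac)
  also have "\<dots> = (\<Sum>n\<in>F. cnj (fcoef q n) * fcoef q n)"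
    unfolding fcoef_def[of q, symmetric]
    by (subst circle_mean_sum[OF F]) (auto intro!: continuous_intros q simp: circle_mean_cmult fcoef_def)
  also have "\<dots> = of_real S"
    unfolding S_def of_real_sum by (intro sum.cong refl) (simp only: complex_norm_square mult.commute)
  finally have qp: "circle_mean (\<lambda>t. q t * cnj (p t)) = of_real S" .
  have "circle_mean (\<lambda>t. cnj (q t * cnj (p t))) = of_real S"
    by (subst circle_mean_cnj) (auto intro!: continuous_intros p q simp: qp)
  then have pq: "circle_mean (\<lambda>t. p t * cnj (q t)) = of_real S"
    by (simp add: mult.commute)
  have "Re (circle_mean (\<lambda>_. 0)) \<le> Re (circle_mean (\<lambda>t. (q t - p t) * cnj (q t - p t)))"
    by (intro Re_circle_mean_mono continuous_intros p q) (simp only: Re_mult_cnj, simp)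
  then have "0 \<le> Re (circle_mean (\<lambda>t. (q t - p t) * cnj (q t - p t)))"
    by (simp add: circle_mean_def)
  also have "(\<lambda>t. (q t - p t) * cnj (q t - p t))
      = (\<lambda>t. (q t * cnj (q t) - q t * cnj (p t)) + (p t * cnj (p t) - p t * cnj (q t)))"
    by (simp add: algebra_simps)
  also have "circle_mean \<dots> = circle_mean (\<lambda>t. q t * cnj (q t)) - of_real S"
    by (subst circle_mean_add, (intro continuous_intros p q)+,
        subst circle_mean_diff, (intro continuous_intros p q)+,
        subst circle_mean_diff, (intro continuous_intros p q)+, simp add: pp pq qp)
  finally show ?thesis by (simp add: S_def)
qed

text \<open>The Riemann-Lebesgue lemma, from the summability of squares in Bessel's inequality. The
  injection \<open>k\<close> allows both ends of the integers.\<close>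

lemma fcoef_tendsto_0:
  assumes q: "continuous_on {0..2 * pi} q" and k: "inj k"
  shows "(\<lambda>n :: nat. fcoef q (k n)) \<longlonglongrightarrow> 0"
proof -
  have "summable (\<lambda>n. (cmod (fcoef q (k n)))\<^sup>2)"
  proof (rule summableI_nonneg_bounded)
    fix n
    have "(\<Sum>i<n. (cmod (fcoef q (k i)))\<^sup>2) = (\<Sum>m\<in>k ` {..<n}. (cmod (fcoef q m))\<^sup>2)"
      by (subst sum.reindex) (use k in \<open>auto intro: inj_on_subset\<close>)
    also have "\<dots> \<le> Re (circle_mean (\<lambda>t. q t * cnj (q t)))"
      by (intro bessel_inequality q) auto
    finally show "(\<Sum>i<n. (cmod (fcoef q (k i)))\<^sup>2) \<le> Re (circle_mean (\<lambda>t. q t * cnj (q t)))" .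
  qed simp
  then have "(\<lambda>n. sqrt ((cmod (fcoef q (k n)))\<^sup>2)) \<longlonglongrightarrow> sqrt 0"
    by (intro tendsto_intros summable_LIMSEQ_zero)
  then show ?thesis by (simp add: tendsto_norm_zero_iff)
qed

lemma fcoef_deriv:
  assumes h: "smooth_periodic h"
  shows "fcoef (dir_deriv 1 h) n = - \<i> * of_int n * fcoef h n"
proof -
  note c = smooth_periodicD(4)[OF h] smooth_periodicD(4)[OF smooth_periodicD(1)[OF h]]
  have "circle_mean (\<lambda>t. h t * (\<i> * of_real (of_int n) * cis (of_int n * t)) + dir_deriv 1 h t * cis (of_int n * t)) = 0"
    using smooth_periodicD(3)[OF h, of 0]
    by (intro circle_mean_deriv[of "\<lambda>t. h t * cis (of_int n * t)"] has_vector_derivative_mult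
        smooth_periodicD(2) h has_vector_derivative_cis) (simp add: cis_int_2pi)
  also have "(\<lambda>t. h t * (\<i> * of_real (of_int n) * cis (of_int n * t)) + dir_deriv 1 h t * cis (of_int n * t))
     = (\<lambda>t. (\<i> * of_int n) * (h t * cis (of_int n * t)) + dir_deriv 1 h t * cis (of_int n * t))"
    by (simp add: mult_ac)
  also have "circle_mean \<dots> = (\<i> * of_int n) * fcoef h n + fcoef (dir_deriv 1 h) n"
    unfolding fcoef_def
    by (subst circle_mean_add) (auto intro!: continuous_intros c simp: circle_mean_cmult)
  finally show ?thesis by (simp add: add_eq_0_iff2)
qed

lemma fcoef_bound:
  assumes "smooth_periodic h"
  obtains B where "B \<ge> 0" "\<And>n. cmod (fcoef h n) \<le> B"
proof -
  obtain B where B: "B \<ge> 0" "\<And>t. cmod (h t) \<le> B" using smooth_periodic_bounded[OF assms] by blast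
  show ?thesis
  proof
    fix n
    show "cmod (fcoef h n) \<le> B"
      unfolding fcoef_def using B
      by (intro norm_circle_mean_le) (auto intro!: continuous_intros smooth_periodicD(4)[OF assms] simp: norm_mult)
  qed (rule B)
qed

section \<open>Convergence of Fourier series of smooth functions, with a rate\<close>

definition fourier_sum :: "(real \<Rightarrow> complex) \<Rightarrow> nat \<Rightarrow> real \<Rightarrow> complex" where
  "fourier_sum h N t = (\<Sum>n\<in>{- int N..int N}. fcoef h n * cis (- of_int n * t))"

lemma int_interval_Suc: "{- int (Suc N)..int (Suc N)} = {- int N..int N} \<union> {- int N - 1, int N + 1}"
  by auto

lemma fourier_sum_Suc:
  "fourier_sum h (Suc N) t = fourier_sum h N t
     + (fcoef h (- int N - 1) * cis (- of_int (- int N - 1) * t) + fcoef h (int N + 1) * cis (- of_int (int N + 1) * t))"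
  unfolding fourier_sum_def int_interval_Suc
  by (subst sum.union_disjoint) (auto simp: algebra_simps)

lemma sum_int_telescope:
  fixes G :: "int \<Rightarrow> 'a::ab_group_add"
  shows "(\<Sum>n\<in>{- int N..int N}. G (n + 1) - G n) = G (int N + 1) - G (- int N)"
proof (induction N)
  case (Suc N)
  have "(\<Sum>n\<in>{- int (Suc N)..int (Suc N)}. G (n + 1) - G n)
     = (\<Sum>n\<in>{- int N..int N}. G (n + 1) - G n) + (\<Sum>n\<in>{- int N - 1, int N + 1}. G (n + 1) - G n)"
    unfolding int_interval_Suc by (rule sum.union_disjoint) auto
  also have "\<dots> = (G (int N + 1) - G (- int N)) + ((G (- int N) - G (- int N - 1)) + (G (int N + 1 + 1) - G (int N + 1)))"
    unfolding Suc by simp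
  also have "\<dots> = G (int N + 1 + 1) - G (- int N - 1)"
    by simp
  also have "int N + 1 + 1 = int (Suc N) + 1" by simp
  also have "- int N - 1 = - int (Suc N)" by simp
  finally show ?case .
qed simp

text \<open>
  Writing \<open>h t - h t\<^sub>0 = q t (cis (t - t\<^sub>0) - 1)\<close> with continuous \<open>q\<close> turns the partial Fourier sums
  at \<open>t\<^sub>0\<close> into telescoping sums of the Fourier coefficients of \<open>q\<close>.
\<close>

lemma vector_derivative_quotient:
  fixes f :: "real \<Rightarrow> 'a::real_normed_vector"
  assumes "(f has_vector_derivative d) (at t)"
  shows "((\<lambda>y. (f y - f t) /\<^sub>R (y - t)) \<longlongrightarrow> d) (at t)"
proof -
  have "((\<lambda>y. (f y - f t - (y - t) *\<^sub>R d) /\<^sub>R \<bar>y - t\<bar>) \<longlongrightarrow> 0) (at t)"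
    using assms by (simp add: has_vector_derivative_def has_derivative_at_within)
  then have "((\<lambda>y. norm ((f y - f t - (y - t) *\<^sub>R d) /\<^sub>R \<bar>y - t\<bar>)) \<longlongrightarrow> 0) (at t)"
    by (rule tendsto_norm_zero)
  moreover have "norm ((f y - f t - (y - t) *\<^sub>R d) /\<^sub>R \<bar>y - t\<bar>) = norm ((f y - f t) /\<^sub>R (y - t) - d)"
    if "y \<noteq> t" for y
  proof -
    have "(f y - f t) /\<^sub>R (y - t) - d = (f y - f t - (y - t) *\<^sub>R d) /\<^sub>R (y - t)"
      using that by (simp add: scaleR_diff_right)
    then show ?thesis by simp
  qed
  ultimately have "((\<lambda>y. norm ((f y - f t) /\<^sub>R (y - t) - d)) \<longlongrightarrow> 0) (at t)"
    by (elim Lim_transform_eventually) (auto simp: eventually_at_filter)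
  then show ?thesis
    by (rule Lim_null[THEN iffD2, OF tendsto_norm_zero_cancel])
qed

lemma difference_quotient_cis:
  assumes h: "smooth_periodic h"
  obtains q where "continuous_on UNIV q" "\<And>t. h t = h t0 + q t * (cis (t - t0) - 1)"
proof -
  define g where "g t = cis (t - t0) - 1" for t
  \<comment> \<open>At each zero of \<open>g\<close>, that is at every translate of
    \<open>t0\<close> by a multiple of \<open>2 * pi\<close>, the derivative of \<open>g\<close> is
    \<open>\<i>\<close>. The default value is therefore the limit of the quotient, and
    \<open>q\<close> is continuous on the whole line.\<close>
  define q where "q t = (if g t = 0 then dir_deriv 1 h t / \<i> else (h t - h t0) / g t)" for t
  have g: "continuous_on UNIV g" unfolding g_def by (intro continuous_intros)
  have hq: "h t = h t0" if "g t = 0" for t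
  proof -
    have "cos (t - t0) = 1" using that by (simp add: g_def complex_eq_iff)
    then obtain n :: int where "t - t0 = of_int n * 2 * pi" using cos_one_2pi_int by blast
    then have "t = t0 + of_int n * (2 * pi)" by simp
    then show ?thesis using periodic_plus_int[of h "2 * pi" t0 n] smooth_periodicD(3)[OF h] by simp
  qed
  have "isCont q t" for t
  proof (cases "g t = 0")
    case False
    have "open {t. g t \<noteq> 0}"
      using g by (intro open_Collect_neq continuous_intros)
    moreover have "continuous_on {t. g t \<noteq> 0} q"
      using g smooth_periodicD(4)[OF h]
      by (subst continuous_on_cong[OF refl, of _ _ "\<lambda>t. (h t - h t0) / g t"])
        (auto simp: q_def intro!: continuous_intros continuous_on_subset[of UNIV g])
    ultimately show ?thesis using False by (simp add: continuous_on_eq_continuous_at)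
  next
    case True
    have "(g has_vector_derivative \<i> * cis (t - t0)) (at t)"
      unfolding g_def has_vector_derivative_def
      by (rule derivative_eq_intros refl | simp)+
    also have "cis (t - t0) = 1" using True by (simp add: g_def)
    finally have dg: "((\<lambda>y. (g y - g t) /\<^sub>R (y - t)) \<longlongrightarrow> \<i>) (at t)"
      using vector_derivative_quotient[of g \<i> t] by simp
    have dh: "((\<lambda>y. (h y - h t) /\<^sub>R (y - t)) \<longlongrightarrow> dir_deriv 1 h t) (at t)"
      by (intro vector_derivative_quotient smooth_periodicD(2) h)
    have lim: "((\<lambda>y. ((h y - h t) /\<^sub>R (y - t)) / ((g y - g t) /\<^sub>R (y - t))) \<longlongrightarrow> dir_deriv 1 h t / \<i>) (at t)"
      by (intro tendsto_divide dg dh) simp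
    have "\<forall>\<^sub>F y in at t. (g y - g t) /\<^sub>R (y - t) \<noteq> 0"
      by (rule tendsto_imp_eventually_ne[OF dg]) simp
    then have "\<forall>\<^sub>F y in at t. ((h y - h t) /\<^sub>R (y - t)) / ((g y - g t) /\<^sub>R (y - t)) = q y"
      by eventually_elim (use True hq[OF True] in \<open>auto simp: q_def scaleR_conv_of_real\<close>)
    with lim have "(q \<longlongrightarrow> dir_deriv 1 h t / \<i>) (at t)"
      by (rule Lim_transform_eventually)
    then show ?thesis using True by (simp add: isCont_def q_def)
  qed
  then have "continuous_on UNIV q" by (simp add: continuous_at_imp_continuous_on)
  moreover have "h t = h t0 + q t * (cis (t - t0) - 1)" for t
    using hq[of t] by (simp add: q_def flip: g_def)
  ultimately show ?thesis using that by blast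
qed

lemma fourier_sum_tendsto:
  assumes h: "smooth_periodic h"
  shows "(\<lambda>N. fourier_sum h N t0) \<longlonglongrightarrow> h t0"
proof -
  obtain q where q: "continuous_on UNIV q" and hq: "\<And>t. h t = h t0 + q t * (cis (t - t0) - 1)"
    using difference_quotient_cis[OF h] by blast
  have q: "continuous_on S q" for S using q continuous_on_subset by blast
  define G where "G n = fcoef q n * cis (- of_int n * t0)" for n
  \<comment> \<open>Multiplication by \<open>cis (t - t0)\<close> shifts the index of the
    coefficients of \<open>q\<close> by one, and the phase in \<open>G\<close> turns this shift into
    a difference. The constant \<open>h t0\<close> contributes to \<open>n = 0\<close> only.\<close>
  have coef: "fcoef h n * cis (- of_int n * t0) = (if n = 0 then h t0 else 0) + (G (n + 1) - G n)" for n
  proof -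
    have "(\<lambda>t. h t * cis (of_int n * t)) = (\<lambda>t. h t0 * cis (of_int n * t)
        + (cis (- t0) * (q t * cis (of_int (n + 1) * t)) - q t * cis (of_int n * t)))"
      by (rule ext, subst hq) (simp add: algebra_simps cis_mult)
    then have fh: "fcoef h n = h t0 * (if n = 0 then 1 else 0) + (cis (- t0) * fcoef q (n + 1) - fcoef q n)"
      unfolding fcoef_def circle_mean_cis[symmetric]
      by (simp only:) (subst circle_mean_add, (intro continuous_intros q)+,
          subst circle_mean_diff, (intro continuous_intros q)+, simp only: circle_mean_cmult)
    show ?thesis unfolding fh G_def by (cases "n = 0") (simp_all add: algebra_simps cis_mult)
  qed
  have "fourier_sum h N t0 = h t0 + (G (int N + 1) - G (- int N))" for N
    unfolding fourier_sum_def coef sum.distrib sum_int_telescope by simp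
  moreover have "(\<lambda>N. G (k N)) \<longlonglongrightarrow> 0" if "inj k" for k :: "nat \<Rightarrow> int"
  proof (rule tendsto_norm_zero_cancel)
    show "(\<lambda>N. cmod (G (k N))) \<longlonglongrightarrow> 0"
      unfolding G_def norm_mult norm_cis mult_1_right
      by (intro tendsto_norm_zero fcoef_tendsto_0 q that)
  qed
  from this[of "\<lambda>N. int N + 1"] this[of "\<lambda>N. - int N"]
  have "(\<lambda>N. G (int N + 1)) \<longlonglongrightarrow> 0" "(\<lambda>N. G (- int N)) \<longlonglongrightarrow> 0"
    by (simp_all add: inj_def)
  ultimately show ?thesis by (auto intro!: tendsto_eq_intros)
qed

text \<open>The seminorms need convergence uniform in \<open>t\<close>. Two derivatives bound the
  coefficients by \<open>B / n^2\<close>, and comparison with \<open>1 / x - 1 / (x + 1)\<close>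
  makes the tails telescope. Pointwise convergence identifies the limit as the number of added terms
  grows with \<open>N\<close> fixed.\<close>

lemma fourier_sum_rate:
  assumes h: "smooth_periodic h"
  obtains C where "C \<ge> 0" "\<And>N t. N \<ge> 1 \<Longrightarrow> cmod (h t - fourier_sum h N t) \<le> C / of_nat N"
proof -
  note h1 = smooth_periodicD(1)[OF h]
  obtain B where B: "B \<ge> 0" "\<And>n. cmod (fcoef (dir_deriv 1 (dir_deriv 1 h)) n) \<le> B"
    using fcoef_bound[OF smooth_periodicD(1)[OF h1]] by blast
  have bound: "cmod (fcoef h n * cis x) \<le> B / (of_int n)\<^sup>2" if "n \<noteq> 0" for n x
  proof -
    have "fcoef (dir_deriv 1 (dir_deriv 1 h)) n = - (of_int n)\<^sup>2 * fcoef h n"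
      unfolding fcoef_deriv[OF h1] fcoef_deriv[OF h] by (simp add: power2_eq_square mult_ac)
    with B(2)[of n] that show ?thesis by (simp add: norm_mult norm_power field_simps)
  qed
  have cauchy: "cmod (fourier_sum h (N + k) t - fourier_sum h N t) \<le> 2 * B * (1 / of_nat N - 1 / of_nat (N + k))"
    if "N \<ge> 1" for N k t
  proof (induction k)
    case (Suc k)
    let ?M = "N + k"
    let ?d = "fcoef h (- int ?M - 1) * cis (- of_int (- int ?M - 1) * t) + fcoef h (int ?M + 1) * cis (- of_int (int ?M + 1) * t)"
    have "cmod ?d \<le> B / (of_int (- int ?M - 1))\<^sup>2 + B / (of_int (int ?M + 1))\<^sup>2"
      by (intro norm_triangle_le add_mono bound) auto
    also have "\<dots> = 2 * B * (1 / (of_nat (Suc ?M))\<^sup>2)"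
      by (simp add: power2_eq_square algebra_simps)
    also have "\<dots> \<le> 2 * B * (1 / of_nat ?M - 1 / of_nat (Suc ?M))"
    proof (intro mult_left_mono)
      define x where "x = real ?M"
      have x: "x > 0" using that by (simp add: x_def)
      have "1 / (x + 1)\<^sup>2 \<le> 1 / (x * (x + 1))"
        using x by (intro divide_left_mono) (auto simp: power2_eq_square)
      also have "\<dots> = 1 / x - 1 / (x + 1)"
        using x by (simp add: field_simps)
      finally show "1 / (real (Suc ?M))\<^sup>2 \<le> 1 / real ?M - 1 / real (Suc ?M)"
        by (simp add: x_def add_ac)
    qed (use B in simp)
    finally have "cmod ?d \<le> 2 * B * (1 / of_nat ?M - 1 / of_nat (Suc ?M))" .
    moreover have "fourier_sum h (N + Suc k) t - fourier_sum h N t = (fourier_sum h ?M t - fourier_sum h N t) + ?d"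
      unfolding add_Suc_right fourier_sum_Suc by simp
    ultimately have "cmod (fourier_sum h (N + Suc k) t - fourier_sum h N t)
        \<le> 2 * B * (1 / of_nat N - 1 / of_nat ?M) + 2 * B * (1 / of_nat ?M - 1 / of_nat (Suc ?M))"
      using Suc.IH by (metis norm_triangle_le add_mono)
    then show ?case by (simp add: algebra_simps)
  qed simp
  have le: "cmod (fourier_sum h (k + N) t - fourier_sum h N t) \<le> 2 * B / of_nat N" if "N \<ge> 1" for N k t
  proof -
    have "2 * B * (1 / of_nat N - 1 / of_nat (N + k)) \<le> 2 * B * (1 / of_nat N)"
      using B by (intro mult_left_mono) auto
    with cauchy[OF that, of k t] show ?thesis by (simp add: add.commute)
  qed
  show ?thesis
  proof
    fix N :: nat and t assume N: "N \<ge> 1"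
    have "(\<lambda>k. cmod (fourier_sum h (k + N) t - fourier_sum h N t)) \<longlonglongrightarrow> cmod (h t - fourier_sum h N t)"
      by (intro tendsto_intros LIMSEQ_ignore_initial_segment fourier_sum_tendsto h)
    then show "cmod (h t - fourier_sum h N t) \<le> 2 * B / of_nat N"
      by (rule tendsto_upperbound) (use le[OF N] in auto)
  qed (use B in simp)
qed

text \<open>Partial sums commute with differentiation, so a derivative of the remainder is the
  remainder of a derivative and the rate applies to it.\<close>

lemma fourier_sum_deriv:
  assumes "smooth_periodic h"
  shows "(fourier_sum h N has_vector_derivative fourier_sum (dir_deriv 1 h) N t) (at t)"
  unfolding fourier_sum_def fcoef_deriv[OF assms]
proof (rule has_vector_derivative_sum)
  fix n
  have "((\<lambda>t. fcoef h n * cis (- of_int n * t)) has_vector_derivative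
      fcoef h n * (\<i> * of_real (- of_int n) * cis (- of_int n * t))) (at t)"
    by (intro has_vector_derivative_mult_right has_vector_derivative_cis)
  then show "((\<lambda>t. fcoef h n * cis (- of_int n * t)) has_vector_derivative
      - \<i> * of_int n * fcoef h n * cis (- of_int n * t)) (at t)"
    by (simp add: mult_ac)
qed

lemma smooth_periodic_cis: "smooth_periodic (\<lambda>t. cis (of_int n * t))"
proof -
  have "C_infinity (\<lambda>t. exp ((\<i> * of_int n) * complex_of_real t))"
    by (intro C_infinity_exp C_infinity_mult C_infinity_const C_infinity_linear bounded_linear_of_real)
  then have "C_infinity (\<lambda>t. cis (of_int n * t))" by (simp add: cis_conv_exp mult.assoc)
  then show ?thesis using cis_int_2pi[of n] by (simp add: smooth_periodic_def distrib_left flip: cis_mult)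
qed

section \<open>Multiplication by a phase as a Toeplitz matrix\<close>

definition phase :: "(real \<Rightarrow> real) \<Rightarrow> int \<Rightarrow> real \<Rightarrow> complex" where
  "phase A \<xi> t = exp (\<i> * complex_of_real (- of_int \<xi> * A t))"

text \<open>The square of the Japanese bracket: the exponent \<open>s\<close> here stands for
  \<open>2 * s\<close> there, and natural powers become polynomials in \<tau> and \<xi>.\<close>

definition bracket2 :: "int \<Rightarrow> int \<Rightarrow> real" where
  "bracket2 \<xi> \<tau> = 1 + (of_int \<tau>)\<^sup>2 + (of_int \<xi>)\<^sup>2"

lemma bracket2_ge_1: "bracket2 \<xi> \<tau> \<ge> 1"
  by (simp add: bracket2_def)

lemma smooth_periodic_phase: "smooth_circle_fun A \<Longrightarrow> smooth_periodic (phase A \<xi>)"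
  unfolding phase_def by (rule smooth_periodic_exp_ii)

lemma cmod_phase: "cmod (phase A \<xi> t) = 1"
  unfolding phase_def by (rule norm_exp_i_times)

lemma dir_deriv_mult_phase:
  assumes A: "smooth_circle_fun A" and b: "smooth_periodic b"
  shows "dir_deriv 1 (\<lambda>t. b t * phase A \<xi> t) = (\<lambda>t. dir_deriv 1 b t * phase A \<xi> t
     + (- \<i> * of_int \<xi>) * ((b t * of_real (dir_deriv 1 A t)) * phase A \<xi> t))"
proof (rule ext, rule dir_deriv_1_eqI)
  fix t
  have "(A has_real_derivative dir_deriv 1 A t) (at t)"
    using A unfolding has_real_derivative_iff_has_vector_derivative
    by (intro has_vector_derivative_dir_deriv C_infinityD) (simp add: smooth_circle_fun_def)
  then have "((\<lambda>t. \<i> * complex_of_real (- of_int \<xi> * A t)) has_vector_derivative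
      \<i> * complex_of_real (- of_int \<xi> * dir_deriv 1 A t)) (at t)"
    by (intro has_vector_derivative_mult_right has_vector_derivative_of_real DERIV_cmult)
  from field_vector_diff_chain_at[OF this DERIV_exp]
  have "(phase A \<xi> has_vector_derivative
      \<i> * complex_of_real (- of_int \<xi> * dir_deriv 1 A t) * phase A \<xi> t) (at t)"
    by (simp add: o_def phase_def[abs_def])
  from has_vector_derivative_mult[OF smooth_periodicD(2)[OF b] this]
  show "((\<lambda>t. b t * phase A \<xi> t) has_vector_derivative dir_deriv 1 b t * phase A \<xi> t
     + (- \<i> * of_int \<xi>) * ((b t * of_real (dir_deriv 1 A t)) * phase A \<xi> t)) (at t)"
    by (simp add: algebra_simps)
qed

text \<open>For \<open>n = \<sigma> - \<tau>\<close> the left side is an entry of the commutator of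
  the matrix with multiplication by the index. Integration by parts moves the derivative onto
  \<open>b\<close> or onto the phase, and the latter produces the factor \<xi>.\<close>

lemma fcoef_mult_phase_by_parts:
  assumes A: "smooth_circle_fun A" and b: "smooth_periodic b"
  shows "of_int n * fcoef (\<lambda>t. b t * phase A \<xi> t) n =
    \<i> * fcoef (\<lambda>t. dir_deriv 1 b t * phase A \<xi> t) n
    + of_int \<xi> * fcoef (\<lambda>t. (b t * of_real (dir_deriv 1 A t)) * phase A \<xi> t) n"
proof -
  note s = smooth_periodic_mult[OF _ smooth_periodic_phase[OF A, of \<xi>]]
  note c = smooth_periodicD(4)[OF s] smooth_periodicD(4)[OF smooth_periodicD(1)[OF b]]
     smooth_periodicD(4)[OF b] smooth_periodicD(4)[OF smooth_periodic_phase[OF A]]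
     smooth_periodicD(4)[OF smooth_periodic_of_real[OF smooth_circle_fun_deriv[OF A]]]
  have "- \<i> * of_int n * fcoef (\<lambda>t. b t * phase A \<xi> t) n
      = fcoef (\<lambda>t. dir_deriv 1 b t * phase A \<xi> t
     + (- \<i> * of_int \<xi>) * ((b t * of_real (dir_deriv 1 A t)) * phase A \<xi> t)) n"
    unfolding fcoef_deriv[OF s[OF b], symmetric] dir_deriv_mult_phase[OF A b] ..
  also have "\<dots> = fcoef (\<lambda>t. dir_deriv 1 b t * phase A \<xi> t) n
     + (- \<i> * of_int \<xi>) * fcoef (\<lambda>t. (b t * of_real (dir_deriv 1 A t)) * phase A \<xi> t) n"
    unfolding fcoef_def circle_mean_cmult[symmetric] distrib_right
    by (subst circle_mean_add) (auto intro!: continuous_intros c simp: mult_ac)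
  finally have "\<i> * (- \<i> * of_int n * fcoef (\<lambda>t. b t * phase A \<xi> t) n) = \<i> * (\<dots>)" by (rule arg_cong)
  then show ?thesis by (simp add: algebra_simps)
qed

text \<open>The rows are Fourier coefficients of \<open>m * p\<close>, where \<open>p\<close> is the
  trigonometric polynomial with coefficients \<open>v\<close>. Bessel's inequality, the pointwise
  bound on \<open>m\<close> and Parseval's identity for \<open>p\<close> give the constant.\<close>

lemma mat_bound_toeplitz:
  assumes m: "continuous_on {0..2 * pi} m" and B: "B \<ge> 0" "\<And>t. cmod (m t) \<le> B"
  shows "mat_bound (\<lambda>_. 1) (\<lambda>\<tau> \<sigma>. fcoef m (\<sigma> - \<tau>)) (B\<^sup>2)"
  unfolding mat_bound_def
proof (intro allI impI)
  fix E F :: "int set" and v :: "int \<Rightarrow> complex"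
  assume E: "finite E" and F: "finite F"
  define p where "p t = (\<Sum>\<sigma>\<in>E. v \<sigma> * cis (of_int \<sigma> * t))" for t
  have p: "continuous_on {0..2 * pi} p" unfolding p_def by (intro continuous_intros)
  have T: "(\<Sum>\<sigma>\<in>E. fcoef m (\<sigma> - \<tau>) * v \<sigma>) = fcoef (\<lambda>t. m t * p t) (- \<tau>)" for \<tau>
  proof -
    have "(\<lambda>t. m t * p t * cis (of_int (- \<tau>) * t))
        = (\<lambda>t. \<Sum>\<sigma>\<in>E. v \<sigma> * (m t * cis (of_int (\<sigma> - \<tau>) * t)))"
      unfolding p_def sum_distrib_left sum_distrib_right
      by (intro ext sum.cong refl) (simp add: cis_mult algebra_simps)
    then show ?thesis
      unfolding fcoef_def
      by (simp only:) (subst circle_mean_sum[OF E], intro continuous_intros m,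
        simp add: circle_mean_cmult mult.commute)
  qed
  have "(\<Sum>\<tau>\<in>F. 1 * (cmod (\<Sum>\<sigma>\<in>E. fcoef m (\<sigma> - \<tau>) * v \<sigma>))\<^sup>2)
      = (\<Sum>n\<in>uminus ` F. (cmod (fcoef (\<lambda>t. m t * p t) n))\<^sup>2)"
    unfolding T by (subst sum.reindex) (auto simp: inj_on_def)
  also have "\<dots> \<le> Re (circle_mean (\<lambda>t. (m t * p t) * cnj (m t * p t)))"
    by (intro bessel_inequality continuous_intros m p finite_imageI F)
  also have "\<dots> \<le> Re (circle_mean (\<lambda>t. of_real (B\<^sup>2) * (p t * cnj (p t))))"
  proof (rule Re_circle_mean_mono)
    fix t
    have "(cmod (m t))\<^sup>2 * (cmod (p t))\<^sup>2 \<le> B\<^sup>2 * (cmod (p t))\<^sup>2"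
      by (intro mult_right_mono power_mono B) auto
    moreover have "Re (of_real (B\<^sup>2) * (p t * cnj (p t))) = B\<^sup>2 * Re (p t * cnj (p t))"
      by (rule Re_of_real_mult)
    ultimately show "Re ((m t * p t) * cnj (m t * p t)) \<le> Re (of_real (B\<^sup>2) * (p t * cnj (p t)))"
      by (simp only: Re_mult_cnj norm_mult power_mult_distrib)
  qed (intro continuous_intros m p)+
  also have "\<dots> = B\<^sup>2 * (\<Sum>\<sigma>\<in>E. 1 * (cmod (v \<sigma>))\<^sup>2)"
    unfolding circle_mean_cmult p_def
    by (subst circle_mean_parseval[OF E]) (auto simp flip: of_real_mult simp del: of_real_power)
  finally show "(\<Sum>\<tau>\<in>F. 1 * (cmod (\<Sum>\<sigma>\<in>E. fcoef m (\<sigma> - \<tau>) * v \<sigma>))\<^sup>2)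
      \<le> B\<^sup>2 * (\<Sum>\<sigma>\<in>E. 1 * (cmod (v \<sigma>))\<^sup>2)" .
qed

lemma cmod_add3_power2_le: "(cmod (a + b + c))\<^sup>2 \<le> 4 * (cmod a)\<^sup>2 + 4 * (cmod b)\<^sup>2 + 2 * (cmod c)\<^sup>2"
  using cmod_add_power2_le[of "a + b" c] cmod_add_power2_le[of a b] by simp

text \<open>
  The commutator of multiplication by \<open>b exp (- i \<xi> A)\<close> with \<open>- i d/dt\<close> is an operator of the same kind up to
  a factor \<open>\<xi>\<close>, which the weight absorbs; this gives the integer powers by induction, uniformly in \<open>\<xi>\<close>.
\<close>

lemma mat_bound_mult_phase:
  assumes A: "smooth_circle_fun A"
  shows "smooth_periodic b \<Longrightarrow> \<exists>C\<ge>0. \<forall>\<xi>. mat_bound (\<lambda>\<tau>. bracket2 \<xi> \<tau> ^ N)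
     (\<lambda>\<tau> \<sigma>. fcoef (\<lambda>t. b t * phase A \<xi> t) (\<sigma> - \<tau>)) C"
proof (induction N arbitrary: b)
  case 0
  obtain B where B: "B \<ge> 0" "\<And>t. cmod (b t) \<le> B" using smooth_periodic_bounded[OF 0] by blast
  have "mat_bound (\<lambda>_. 1) (\<lambda>\<tau> \<sigma>. fcoef (\<lambda>t. b t * phase A \<xi> t) (\<sigma> - \<tau>)) (B\<^sup>2)" for \<xi>
    by (intro mat_bound_toeplitz smooth_periodicD(4) smooth_periodic_mult smooth_periodic_phase A 0 B)
      (simp add: norm_mult cmod_phase B)
  then show ?case by (intro exI[of _ "B\<^sup>2"]) simp
next
  case (Suc N)
  let ?b2 = "dir_deriv 1 b" and ?b3 = "\<lambda>t. b t * complex_of_real (dir_deriv 1 A t)"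
  have b: "smooth_periodic ?b2" "smooth_periodic ?b3"
    using Suc.prems A by (auto intro!: smooth_periodic_mult smooth_periodic_of_real smooth_circle_fun_deriv smooth_periodicD)
  let ?K = "\<lambda>b \<xi> \<tau> \<sigma>. fcoef (\<lambda>t. b t * phase A \<xi> t) (\<sigma> - \<tau>)"
  obtain C1 where "C1 \<ge> 0" and C1: "\<forall>\<xi>. mat_bound (\<lambda>\<tau>. bracket2 \<xi> \<tau> ^ N) (?K b \<xi>) C1"
    using Suc.IH[OF Suc.prems] by (elim exE conjE)
  obtain C2 where "C2 \<ge> 0" and C2: "\<forall>\<xi>. mat_bound (\<lambda>\<tau>. bracket2 \<xi> \<tau> ^ N) (?K ?b2 \<xi>) C2"
    using Suc.IH[OF b(1)] by (elim exE conjE)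
  obtain C3 where "C3 \<ge> 0" and C3: "\<forall>\<xi>. mat_bound (\<lambda>\<tau>. bracket2 \<xi> \<tau> ^ N) (?K ?b3 \<xi>) C3"
    using Suc.IH[OF b(2)] by (elim exE conjE)
  note C = \<open>C1 \<ge> 0\<close> \<open>C2 \<ge> 0\<close> \<open>C3 \<ge> 0\<close>
  have "mat_bound (\<lambda>\<tau>. bracket2 \<xi> \<tau> ^ Suc N) (?K b \<xi>) (4 * C1 + 4 * C2 + 2 * C3)" for \<xi>
    unfolding mat_bound_def
  proof (intro allI impI)
    fix E F :: "int set" and v :: "int \<Rightarrow> complex"
    assume E: "finite E" and F: "finite F"
    let ?T = "\<lambda>b v \<tau>. \<Sum>\<sigma>\<in>E. ?K b \<xi> \<tau> \<sigma> * v \<sigma>"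
    let ?w = "\<lambda>\<tau>. bracket2 \<xi> \<tau> ^ N"
    let ?X = "of_int \<xi> :: real"
    have w: "?w \<tau> \<ge> 0" for \<tau> using bracket2_ge_1[of \<xi> \<tau>] by simp
    \<comment> \<open>The splitting \<open>\<tau> = \<sigma> - (\<sigma> - \<tau>)\<close>: the
      first part moves onto \<open>v\<close>, the second is the integration by parts.\<close>
    have comm: "of_int \<tau> * ?T b v \<tau> = ?T b (\<lambda>\<sigma>. of_int \<sigma> * v \<sigma>) \<tau>
        + (- \<i>) * ?T ?b2 v \<tau> + (- of_int \<xi>) * ?T ?b3 v \<tau>" for \<tau>
      unfolding sum_distrib_left sum.distrib[symmetric]
    proof (intro sum.cong refl)
      fix \<sigma>
      have "of_int \<tau> * (?K b \<xi> \<tau> \<sigma> * v \<sigma>) = ?K b \<xi> \<tau> \<sigma> * (of_int \<sigma> * v \<sigma>)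
          - (of_int (\<sigma> - \<tau>) * ?K b \<xi> \<tau> \<sigma>) * v \<sigma>"
        by (simp add: algebra_simps)
      also have "of_int (\<sigma> - \<tau>) * ?K b \<xi> \<tau> \<sigma> = \<i> * ?K ?b2 \<xi> \<tau> \<sigma> + of_int \<xi> * ?K ?b3 \<xi> \<tau> \<sigma>"
        by (rule fcoef_mult_phase_by_parts[OF A Suc.prems])
      finally show "of_int \<tau> * (?K b \<xi> \<tau> \<sigma> * v \<sigma>) = ?K b \<xi> \<tau> \<sigma> * (of_int \<sigma> * v \<sigma>)
          + (- \<i>) * (?K ?b2 \<xi> \<tau> \<sigma> * v \<sigma>) + (- of_int \<xi>) * (?K ?b3 \<xi> \<tau> \<sigma> * v \<sigma>)"
        by (simp add: algebra_simps)
    qed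
    \<comment> \<open>One factor of the weight is \<open>1 + \<xi>^2\<close> plus
      \<open>\<tau>^2\<close>; only \<open>\<tau>^2\<close> has to pass through the
      commutator.\<close>
    have pt: "bracket2 \<xi> \<tau> ^ Suc N * (cmod (?T b v \<tau>))\<^sup>2
        \<le> (1 + ?X\<^sup>2) * (?w \<tau> * (cmod (?T b v \<tau>))\<^sup>2) + 4 * (?w \<tau> * (cmod (?T b (\<lambda>\<sigma>. of_int \<sigma> * v \<sigma>) \<tau>))\<^sup>2)
          + 4 * (?w \<tau> * (cmod (?T ?b2 v \<tau>))\<^sup>2) + 2 * ?X\<^sup>2 * (?w \<tau> * (cmod (?T ?b3 v \<tau>))\<^sup>2)" for \<tau>
    proof -
      have "(of_int \<tau>)\<^sup>2 * (cmod (?T b v \<tau>))\<^sup>2 = (cmod (of_int \<tau> * ?T b v \<tau>))\<^sup>2"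
        by (simp add: norm_mult power_mult_distrib)
      also have "\<dots> \<le> 4 * (cmod (?T b (\<lambda>\<sigma>. of_int \<sigma> * v \<sigma>) \<tau>))\<^sup>2 + 4 * (cmod ((- \<i>) * ?T ?b2 v \<tau>))\<^sup>2
          + 2 * (cmod ((- of_int \<xi>) * ?T ?b3 v \<tau>))\<^sup>2"
        unfolding comm by (rule cmod_add3_power2_le)
      also have "\<dots> = 4 * (cmod (?T b (\<lambda>\<sigma>. of_int \<sigma> * v \<sigma>) \<tau>))\<^sup>2 + 4 * (cmod (?T ?b2 v \<tau>))\<^sup>2
          + 2 * (?X\<^sup>2 * (cmod (?T ?b3 v \<tau>))\<^sup>2)"
        by (simp add: norm_mult power_mult_distrib)
      finally have "?w \<tau> * ((of_int \<tau>)\<^sup>2 * (cmod (?T b v \<tau>))\<^sup>2) \<le> ?w \<tau> * \<dots>"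
        using w by (rule mult_left_mono)
      then show ?thesis by (simp add: bracket2_def algebra_simps)
    qed
    have "(\<Sum>\<tau>\<in>F. bracket2 \<xi> \<tau> ^ Suc N * (cmod (?T b v \<tau>))\<^sup>2)
        \<le> (1 + ?X\<^sup>2) * (\<Sum>\<tau>\<in>F. ?w \<tau> * (cmod (?T b v \<tau>))\<^sup>2)
          + 4 * (\<Sum>\<tau>\<in>F. ?w \<tau> * (cmod (?T b (\<lambda>\<sigma>. of_int \<sigma> * v \<sigma>) \<tau>))\<^sup>2)
          + 4 * (\<Sum>\<tau>\<in>F. ?w \<tau> * (cmod (?T ?b2 v \<tau>))\<^sup>2)
          + 2 * ?X\<^sup>2 * (\<Sum>\<tau>\<in>F. ?w \<tau> * (cmod (?T ?b3 v \<tau>))\<^sup>2)"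
      unfolding sum_distrib_left sum.distrib[symmetric] by (rule sum_mono[OF pt])
    also have "\<dots> \<le> (1 + ?X\<^sup>2) * (C1 * (\<Sum>\<sigma>\<in>E. ?w \<sigma> * (cmod (v \<sigma>))\<^sup>2))
          + 4 * (C1 * (\<Sum>\<sigma>\<in>E. ?w \<sigma> * (cmod (of_int \<sigma> * v \<sigma>))\<^sup>2))
          + 4 * (C2 * (\<Sum>\<sigma>\<in>E. ?w \<sigma> * (cmod (v \<sigma>))\<^sup>2))
          + 2 * ?X\<^sup>2 * (C3 * (\<Sum>\<sigma>\<in>E. ?w \<sigma> * (cmod (v \<sigma>))\<^sup>2))"
      by (intro add_mono mult_left_mono mat_boundD[OF C1[rule_format] E F] mat_boundD[OF C2[rule_format] E F]
          mat_boundD[OF C3[rule_format] E F]) auto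
    also have "\<dots> = (\<Sum>\<sigma>\<in>E. (?w \<sigma> * (cmod (v \<sigma>))\<^sup>2)
        * ((1 + ?X\<^sup>2) * C1 + 4 * C1 * (of_int \<sigma>)\<^sup>2 + 4 * C2 + 2 * ?X\<^sup>2 * C3))"
      by (simp add: sum_distrib_left sum.distrib norm_mult power_mult_distrib algebra_simps)
    also have "\<dots> \<le> (\<Sum>\<sigma>\<in>E. (?w \<sigma> * (cmod (v \<sigma>))\<^sup>2) * ((4 * C1 + 4 * C2 + 2 * C3) * bracket2 \<xi> \<sigma>))"
    proof (intro sum_mono mult_left_mono)
      fix \<sigma>
      \<comment> \<open>The difference of the two sides. The \<open>\<xi>^2\<close> in front of
        \<open>C3\<close> is cancelled by the one in \<open>bracket2\<close>: this is the absorption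
        of the commutator factor.\<close>
      have "0 \<le> C1 * (3 + 3 * ?X\<^sup>2) + C2 * (4 * (of_int \<sigma>)\<^sup>2 + 4 * ?X\<^sup>2) + C3 * (2 + 2 * (of_int \<sigma>)\<^sup>2)"
        using C by simp
      then show "(1 + ?X\<^sup>2) * C1 + 4 * C1 * (of_int \<sigma>)\<^sup>2 + 4 * C2 + 2 * ?X\<^sup>2 * C3
          \<le> (4 * C1 + 4 * C2 + 2 * C3) * bracket2 \<xi> \<sigma>"
        by (simp add: bracket2_def algebra_simps)
    qed (use w in simp)
    also have "\<dots> = (4 * C1 + 4 * C2 + 2 * C3) * (\<Sum>\<sigma>\<in>E. bracket2 \<xi> \<sigma> ^ Suc N * (cmod (v \<sigma>))\<^sup>2)"
      by (simp add: sum_distrib_left mult_ac)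
    finally show "(\<Sum>\<tau>\<in>F. bracket2 \<xi> \<tau> ^ Suc N * (cmod (?T b v \<tau>))\<^sup>2)
        \<le> (4 * C1 + 4 * C2 + 2 * C3) * (\<Sum>\<sigma>\<in>E. bracket2 \<xi> \<sigma> ^ Suc N * (cmod (v \<sigma>))\<^sup>2)" .
  qed
  then show ?case using C by (intro exI[of _ "4 * C1 + 4 * C2 + 2 * C3"]) simp
qed

text \<open>Entry by entry, the conjugate transpose of the matrix for \<open>- A\<close> is the
  matrix for \<open>A\<close>, because the phases are conjugate to each other.\<close>

lemma cnj_fcoef_phase:
  assumes A: "smooth_circle_fun A"
  shows "cnj (fcoef (phase (\<lambda>t. - A t) \<xi>) n) = fcoef (phase A \<xi>) (- n)"
proof -
  have "cnj (fcoef (phase (\<lambda>t. - A t) \<xi>) n)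
      = circle_mean (\<lambda>t. cnj (phase (\<lambda>t. - A t) \<xi> t * cis (of_int n * t)))"
    unfolding fcoef_def
    by (intro circle_mean_cnj[symmetric] continuous_intros smooth_periodicD(4) smooth_periodic_phase
        smooth_circle_fun_minus A)
  also have "\<dots> = fcoef (phase A \<xi>) (- n)"
    by (simp add: fcoef_def phase_def exp_cnj cis_cnj)
  finally show ?thesis .
qed

lemma mat_bound_mono:
  fixes w :: "'i \<Rightarrow> real"
  assumes "mat_bound w K C" "C \<le> D" "\<And>i. w i \<ge> 0"
  shows "mat_bound w K D"
  unfolding mat_bound_def
proof (intro allI impI)
  fix E F :: "'i set" and v :: "'i \<Rightarrow> complex"
  assume "finite E" "finite F"
  from mat_boundD[OF assms(1) this]
  have "(\<Sum>i\<in>F. w i * (cmod (\<Sum>j\<in>E. K i j * v j))\<^sup>2) \<le> C * (\<Sum>j\<in>E. w j * (cmod (v j))\<^sup>2)" .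
  also have "\<dots> \<le> D * (\<Sum>j\<in>E. w j * (cmod (v j))\<^sup>2)"
    using assms by (intro mult_right_mono sum_nonneg) auto
  finally show "(\<Sum>i\<in>F. w i * (cmod (\<Sum>j\<in>E. K i j * v j))\<^sup>2) \<le> D * (\<Sum>j\<in>E. w j * (cmod (v j))\<^sup>2)" .
qed

lemma mat_bound_phase:
  assumes A: "smooth_circle_fun A"
  obtains C where "C \<ge> 0" "\<And>\<xi>. mat_bound (\<lambda>\<tau>. bracket2 \<xi> \<tau> powr s) (\<lambda>\<tau> \<sigma>. fcoef (phase A \<xi>) (\<sigma> - \<tau>)) C"
proof -
  note A' = smooth_circle_fun_minus[OF A]
  obtain N :: nat where N: "real N \<ge> \<bar>s\<bar> + 1" using real_arch_simple by blast
  obtain C1 where C1: "C1 \<ge> 0" "\<And>\<xi>. mat_bound (\<lambda>\<tau>. bracket2 \<xi> \<tau> ^ N) (\<lambda>\<tau> \<sigma>. fcoef (phase A \<xi>) (\<sigma> - \<tau>)) C1"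
    using mat_bound_mult_phase[OF A smooth_periodic_const[of 1], of N] by auto
  \<comment> \<open>The positive exponent for \<open>- A\<close>; its adjoint supplies the exponent
    \<open>- N\<close> for \<open>A\<close>.\<close>
  obtain C2 where C2: "C2 \<ge> 0"
    "\<And>\<xi>. mat_bound (\<lambda>\<tau>. bracket2 \<xi> \<tau> ^ N) (\<lambda>\<tau> \<sigma>. fcoef (phase (\<lambda>t. - A t) \<xi>) (\<sigma> - \<tau>)) C2"
    using mat_bound_mult_phase[OF A' smooth_periodic_const[of 1], of N] by auto
  have pos: "bracket2 \<xi> \<tau> > 0" for \<xi> \<tau> using bracket2_ge_1[of \<xi> \<tau>] by linarith
  have "mat_bound (\<lambda>\<tau>. bracket2 \<xi> \<tau> powr s) (\<lambda>\<tau> \<sigma>. fcoef (phase A \<xi>) (\<sigma> - \<tau>))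
      (2 powr (\<bar>s\<bar> + real N) * (16 * max C1 C2))" for \<xi>
  proof (rule mat_bound_interpolate[OF bracket2_ge_1 _ N])
    have "(\<lambda>\<tau>. bracket2 \<xi> \<tau> powr real N) = (\<lambda>\<tau>. bracket2 \<xi> \<tau> ^ N)"
      using pos by (simp add: powr_realpow)
    then show "mat_bound (\<lambda>\<tau>. bracket2 \<xi> \<tau> powr real N) (\<lambda>\<tau> \<sigma>. fcoef (phase A \<xi>) (\<sigma> - \<tau>)) (max C1 C2)"
      using mat_bound_mono[OF C1(2), of "max C1 C2" \<xi>] pos by (simp add: less_imp_le)
    have "(\<lambda>\<tau>. bracket2 \<xi> \<tau> powr (- real N)) = (\<lambda>\<tau>. 1 / bracket2 \<xi> \<tau> ^ N)"
      using pos by (simp add: powr_realpow powr_minus_divide)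
    moreover have "mat_bound (\<lambda>\<tau>. 1 / bracket2 \<xi> \<tau> ^ N) (\<lambda>\<tau> \<sigma>. fcoef (phase A \<xi>) (\<sigma> - \<tau>)) C2"
      using mat_bound_adjoint[OF _ C2, of \<xi>] pos unfolding cnj_fcoef_phase[OF A] by simp
    ultimately show "mat_bound (\<lambda>\<tau>. bracket2 \<xi> \<tau> powr (- real N)) (\<lambda>\<tau> \<sigma>. fcoef (phase A \<xi>) (\<sigma> - \<tau>)) (max C1 C2)"
      using mat_bound_mono[of "\<lambda>\<tau>. 1 / bracket2 \<xi> \<tau> ^ N" _ C2 "max C1 C2"] pos by (simp add: less_imp_le)
  qed (use C1 in simp)
  then show ?thesis using that C1(1) by (metis le_max_iff_disj mult_nonneg_nonneg powr_ge_zero zero_le_numeral)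
qed

section \<open>The operators on Sobolev spaces\<close>

text \<open>These are the only test functions that Fourier coefficients require. Both partial
  derivatives preserve the form with the same \<open>n\<close>, and a shear merely multiplies
  \<open>f\<close> by a phase, which reduces all questions to one variable.\<close>

definition tensor_cis :: "(real \<Rightarrow> complex) \<Rightarrow> int \<Rightarrow> real \<times> real \<Rightarrow> complex" where
  "tensor_cis f n z = f (fst z) * cis (of_int n * snd z)"

lemma test_funs_tensor_cis: "smooth_periodic f \<Longrightarrow> tensor_cis f n \<in> test_funs"
  unfolding tensor_cis_def[abs_def]
  by (intro test_funs_mult test_funs_fst test_funs_snd[of "\<lambda>x. cis (of_int n * x)"] smooth_periodic_cis)

lemma dir_deriv_tensor_cis:
  assumes f: "smooth_periodic f"
  shows "dir_deriv (1, 0) (tensor_cis f n) = tensor_cis (dir_deriv 1 f) n"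
    "dir_deriv (0, 1) (tensor_cis f n) = tensor_cis (\<lambda>t. (\<i> * of_int n) * f t) n"
proof -
  note t = test_funs_tensor_cis[OF f, of n]
  show "dir_deriv (1, 0) (tensor_cis f n) = tensor_cis (dir_deriv 1 f) n"
  proof
    fix z :: "real \<times> real"
    have "((\<lambda>t. tensor_cis f n (t, snd z)) has_vector_derivative dir_deriv 1 f (fst z) * cis (of_int n * snd z)) (at (fst z))"
      unfolding tensor_cis_def fst_conv snd_conv
      by (intro has_vector_derivative_mult_left smooth_periodicD f)
    from vector_derivative_unique_at[OF dir_deriv_slice_fst[OF t] this]
    show "dir_deriv (1, 0) (tensor_cis f n) z = tensor_cis (dir_deriv 1 f) n z"
      by (simp add: tensor_cis_def)
  qed
  show "dir_deriv (0, 1) (tensor_cis f n) = tensor_cis (\<lambda>t. (\<i> * of_int n) * f t) n"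
  proof
    fix z :: "real \<times> real"
    have "((\<lambda>x. tensor_cis f n (fst z, x)) has_vector_derivative
        f (fst z) * (\<i> * of_real (of_int n) * cis (of_int n * snd z))) (at (snd z))"
      unfolding tensor_cis_def fst_conv snd_conv
      by (intro has_vector_derivative_mult_right has_vector_derivative_cis)
    from vector_derivative_unique_at[OF dir_deriv_slice_snd[OF t] this]
    show "dir_deriv (0, 1) (tensor_cis f n) z = tensor_cis (\<lambda>t. (\<i> * of_int n) * f t) n z"
      by (simp add: tensor_cis_def mult_ac)
  qed
qed

lemma smooth_periodic_cmult: "smooth_periodic f \<Longrightarrow> smooth_periodic (\<lambda>t. c * f t)"
  by (rule smooth_periodic_mult[OF smooth_periodic_const])

lemma smooth_periodic_dir_deriv_pow: "smooth_periodic f \<Longrightarrow> smooth_periodic ((dir_deriv 1 ^^ n) f)"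
  by (induction n) (auto intro: smooth_periodicD)

lemma partial_deriv_tensor_cis:
  assumes f: "smooth_periodic f"
  shows "partial_deriv a b (tensor_cis f n) = tensor_cis ((dir_deriv 1 ^^ a) (\<lambda>t. (\<i> * of_int n) ^ b * f t)) n"
proof -
  have 1: "(dir_deriv (0, 1) ^^ b) (tensor_cis f n) = tensor_cis (\<lambda>t. (\<i> * of_int n) ^ b * f t) n"
    by (induction b) (simp_all add: dir_deriv_tensor_cis smooth_periodic_cmult f mult.assoc)
  have 2: "(dir_deriv (1, 0) ^^ a) (tensor_cis g n) = tensor_cis ((dir_deriv 1 ^^ a) g) n"
    if "smooth_periodic g" for g
    by (induction a) (simp_all add: dir_deriv_tensor_cis smooth_periodic_dir_deriv_pow that)
  show ?thesis unfolding partial_deriv_def 1 by (intro 2 smooth_periodic_cmult f)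
qed

lemma smooth_periodic_sum:
  "(\<And>i. i \<in> I \<Longrightarrow> smooth_periodic (f i)) \<Longrightarrow> smooth_periodic (\<lambda>t. \<Sum>i\<in>I. f i t)"
  by (induction I rule: infinite_finite_induct) (auto intro: smooth_periodic_const smooth_periodic_add)

lemma smooth_periodic_fourier_sum: "smooth_periodic (fourier_sum h N)"
  unfolding fourier_sum_def[abs_def]
  by (intro smooth_periodic_sum smooth_periodic_cmult)
    (use smooth_periodic_cis[of "- n" for n] in simp)

lemma smooth_periodic_remainder:
  "smooth_periodic h \<Longrightarrow> smooth_periodic (\<lambda>t. h t - fourier_sum h N t)"
  using smooth_periodic_add[OF _ smooth_periodic_cmult[OF smooth_periodic_fourier_sum, of "- 1"]] by simp

lemma dir_deriv_pow_remainder: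
  "smooth_periodic h \<Longrightarrow> (dir_deriv 1 ^^ a) (\<lambda>t. h t - fourier_sum h N t)
     = (\<lambda>t. (dir_deriv 1 ^^ a) h t - fourier_sum ((dir_deriv 1 ^^ a) h) N t)"
proof (induction a)
  case (Suc a)
  note s = smooth_periodic_dir_deriv_pow[OF Suc.prems, of a]
  have "dir_deriv 1 (\<lambda>t. (dir_deriv 1 ^^ a) h t - fourier_sum ((dir_deriv 1 ^^ a) h) N t)
      = (\<lambda>t. dir_deriv 1 ((dir_deriv 1 ^^ a) h) t - fourier_sum (dir_deriv 1 ((dir_deriv 1 ^^ a) h)) N t)"
    by (rule ext, rule dir_deriv_1_eqI)
      (intro has_vector_derivative_diff smooth_periodicD(2) s fourier_sum_deriv)
  then show ?case by (simp only: Suc.IH[OF Suc.prems] funpow.simps o_apply)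
qed simp

lemma fourier_sum_cmult: "fourier_sum (\<lambda>t. c * h t) N t = c * fourier_sum h N t"
  by (simp add: fourier_sum_def fcoef_def mult.assoc circle_mean_cmult sum_distrib_left)

text \<open>Convergence of the Fourier series in the topology of the test functions: each of the
  finitely many derivatives in the seminorm is itself a remainder and decays like
  \<open>C / N\<close>.\<close>

lemma test_seminorm_remainder_tendsto:
  assumes h: "smooth_periodic h"
  shows "(\<lambda>N. test_seminorm M (tensor_cis (\<lambda>t. h t - fourier_sum h N t) n)) \<longlonglongrightarrow> 0"
proof -
  let ?R = "\<lambda>N. tensor_cis (\<lambda>t. h t - fourier_sum h N t) n"
  note R = test_funs_tensor_cis[OF smooth_periodic_remainder[OF h]]
  have "(\<lambda>N. sup_cmod (partial_deriv a b (?R N))) \<longlonglongrightarrow> 0" for a b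
  proof -
    \<comment> \<open>The smooth function whose remainder appears after differentiation: it carries
      the \<open>t\<close>-derivatives and the factors from the
      \<open>x\<close>-derivatives.\<close>
    define k where "k = (dir_deriv 1 ^^ a) (\<lambda>t. (\<i> * of_int n) ^ b * h t)"
    have "smooth_periodic k"
      unfolding k_def by (intro smooth_periodic_dir_deriv_pow smooth_periodic_cmult h)
    then obtain C where C: "\<And>N t. N \<ge> 1 \<Longrightarrow> cmod (k t - fourier_sum k N t) \<le> C / of_nat N"
      using fourier_sum_rate by blast
    have eq: "partial_deriv a b (?R N) = tensor_cis (\<lambda>t. k t - fourier_sum k N t) n" for N
      using dir_deriv_pow_remainder[OF smooth_periodic_cmult[OF h], of a "(\<i> * of_int n) ^ b" N]
      by (simp add: partial_deriv_tensor_cis smooth_periodic_remainder h k_def right_diff_distrib fourier_sum_cmult)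
    have "sup_cmod (partial_deriv a b (?R N)) \<le> C / of_nat N" if "N \<ge> 1" for N
      unfolding eq by (rule cSUP_least) (use C[OF that] in \<open>auto simp: tensor_cis_def norm_mult\<close>)
    then have upper: "\<forall>\<^sub>F N in sequentially. sup_cmod (partial_deriv a b (?R N)) \<le> C / of_nat N"
      unfolding eventually_sequentially by blast
    have lower: "\<forall>\<^sub>F N in sequentially. 0 \<le> sup_cmod (partial_deriv a b (?R N))"
      by (intro always_eventually allI sup_cmod_nonneg test_funs_partial_deriv R)
    show ?thesis
      by (rule tendsto_sandwich[OF lower upper tendsto_const lim_const_over_n])
  qed
  then have "(\<lambda>N. \<Sum>(a, b)\<in>{(a, b). a + b \<le> M}. sup_cmod (partial_deriv a b (?R N))) \<longlonglongrightarrow> 0"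
    unfolding case_prod_unfold by (intro tendsto_null_sum)
  then show ?thesis by (simp add: test_seminorm_def)
qed

section \<open>Distributions, and the action of \<open>Psi A\<close> on Fourier coefficients\<close>

lemma distributionsD:
  assumes "u \<in> distributions"
  shows "\<phi> \<notin> test_funs \<Longrightarrow> u \<phi> = 0"
    "\<phi> \<in> test_funs \<Longrightarrow> \<psi> \<in> test_funs \<Longrightarrow> u (\<lambda>z. \<phi> z + \<psi> z) = u \<phi> + u \<psi>"
    "\<phi> \<in> test_funs \<Longrightarrow> u (\<lambda>z. c * \<phi> z) = c * u \<phi>"
  using assms unfolding distributions_def by blast+

lemma distributions_bound:
  assumes "u \<in> distributions"
  obtains C N where "C \<ge> 0" "\<And>\<phi>. \<phi> \<in> test_funs \<Longrightarrow> cmod (u \<phi>) \<le> C * test_seminorm N \<phi>"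
proof -
  obtain C N where C: "\<forall>\<phi>\<in>test_funs. cmod (u \<phi>) \<le> C * test_seminorm N \<phi>"
    using assms unfolding distributions_def by blast
  have "cmod (u \<phi>) \<le> \<bar>C\<bar> * test_seminorm N \<phi>" if "\<phi> \<in> test_funs" for \<phi>
    by (rule order_trans[OF C[rule_format, OF that]])
      (intro mult_right_mono abs_ge_self test_seminorm_nonneg that)
  then show ?thesis using that[of "\<bar>C\<bar>" N] by simp
qed

lemma distribution_sum:
  assumes u: "u \<in> distributions"
  shows "finite I \<Longrightarrow> (\<And>i. i \<in> I \<Longrightarrow> f i \<in> test_funs) \<Longrightarrow> u (\<lambda>z. \<Sum>i\<in>I. c i * f i z) = (\<Sum>i\<in>I. c i * u (f i))"
proof (induction I rule: finite_induct)
  case empty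
  show ?case using distributionsD(3)[OF u test_funs_const[of 0], of 0] by simp
next
  case (insert i I)
  then have "u (\<lambda>z. c i * f i z + (\<Sum>i\<in>I. c i * f i z)) = u (\<lambda>z. c i * f i z) + u (\<lambda>z. \<Sum>i\<in>I. c i * f i z)"
    by (intro distributionsD(2)[OF u] test_funs_cmult test_funs_sum) auto
  with insert show ?case by (simp add: distributionsD(3)[OF u])
qed

text \<open>Continuity of \<open>u\<close> for a single seminorm sends the remainder of the series
  to zero. Only symmetric partial sums are controlled.\<close>

lemma distribution_fourier_series:
  assumes u: "u \<in> distributions" and h: "smooth_periodic h"
  shows "(\<lambda>N. \<Sum>\<sigma>\<in>{- int N..int N}. fcoef h \<sigma> * u (tensor_cis (\<lambda>t. cis (- of_int \<sigma> * t)) n))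
     \<longlonglongrightarrow> u (tensor_cis h n)"
proof -
  let ?S = "\<lambda>N. \<Sum>\<sigma>\<in>{- int N..int N}. fcoef h \<sigma> * u (tensor_cis (\<lambda>t. cis (- of_int \<sigma> * t)) n)"
  let ?R = "\<lambda>N. tensor_cis (\<lambda>t. h t - fourier_sum h N t) n"
  obtain C M where C: "\<And>\<phi>. \<phi> \<in> test_funs \<Longrightarrow> cmod (u \<phi>) \<le> C * test_seminorm M \<phi>"
    using distributions_bound[OF u] by blast
  have cis: "smooth_periodic (\<lambda>t. cis (- of_int \<sigma> * t))" for \<sigma>
    using smooth_periodic_cis[of "- \<sigma>"] by simp
  have S: "?S N = u (tensor_cis (fourier_sum h N) n)" for N
  proof -
    have "tensor_cis (fourier_sum h N) n
        = (\<lambda>z. \<Sum>\<sigma>\<in>{- int N..int N}. fcoef h \<sigma> * tensor_cis (\<lambda>t. cis (- of_int \<sigma> * t)) n z)"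
      by (simp add: tensor_cis_def[abs_def] fourier_sum_def sum_distrib_right mult.assoc)
    then show ?thesis
      by (simp only: distribution_sum[OF u _ test_funs_tensor_cis[OF cis]] finite_atLeastAtMost_int)
  qed
  have split: "u (tensor_cis h n) = u (?R N) + ?S N" for N
  proof -
    have "tensor_cis h n = (\<lambda>z. ?R N z + tensor_cis (fourier_sum h N) n z)"
      by (simp add: tensor_cis_def[abs_def] algebra_simps)
    then show ?thesis
      unfolding S using distributionsD(2)[OF u test_funs_tensor_cis[OF smooth_periodic_remainder[OF h]]
        test_funs_tensor_cis[OF smooth_periodic_fourier_sum]] by metis
  qed
  have *: "?S N = u (tensor_cis h n) - u (?R N)" for N
    by (subst split[of N]) (rule add_diff_cancel_left'[symmetric])
  have "(\<lambda>N. C * test_seminorm M (?R N)) \<longlonglongrightarrow> C * 0"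
    by (intro tendsto_intros test_seminorm_remainder_tendsto h)
  then have "(\<lambda>N. u (?R N)) \<longlonglongrightarrow> 0"
    by (intro Lim_null_comparison[of "\<lambda>N. u (?R N)"])
      (auto intro!: always_eventually C test_funs_tensor_cis smooth_periodic_remainder h)
  then have "(\<lambda>N. u (tensor_cis h n) - u (?R N)) \<longlonglongrightarrow> u (tensor_cis h n) - 0"
    by (intro tendsto_diff tendsto_const)
  then show ?thesis unfolding * by simp
qed

lemma inv_shear: "inv (\<lambda>(t, x). (t, x - A t)) = shear A"
  by (rule inv_equality) (auto simp: shear_def)

lemma jacobian_det_shear: "C_infinity A \<Longrightarrow> jacobian_det (shear A) z = 1"
  unfolding jacobian_det_def
  by (simp add: dir_deriv_eqI[OF has_derivative_shear])

text \<open>The shear has Jacobian 1, so the pullback is the plain transpose of composition with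
  it.\<close>

lemma Psi_eq:
  assumes "smooth_circle_fun A"
  shows "Psi A u = (\<lambda>\<phi>. if \<phi> \<in> test_funs then u (\<lambda>z. \<phi> (shear A z)) else 0)"
  using assms unfolding Psi_def pullback_def inv_shear
  by (simp add: jacobian_det_shear smooth_circle_fun_def cong: if_cong)

lemma Psi_distributions:
  assumes A: "smooth_circle_fun A" and u: "u \<in> distributions"
  shows "Psi A u \<in> distributions"
proof -
  obtain C N where C: "C \<ge> 0" "\<And>\<phi>. \<phi> \<in> test_funs \<Longrightarrow> cmod (u \<phi>) \<le> C * test_seminorm N \<phi>"
    using distributions_bound[OF u] by blast
  obtain D where D: "\<And>\<phi>. \<phi> \<in> test_funs \<Longrightarrow> test_seminorm N (\<lambda>z. \<phi> (shear A z)) \<le> D * test_seminorm N \<phi>"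
    using test_seminorm_shear[OF A] by blast
  have "cmod (Psi A u \<phi>) \<le> (C * D) * test_seminorm N \<phi>" if "\<phi> \<in> test_funs" for \<phi>
  proof -
    have "cmod (Psi A u \<phi>) \<le> C * test_seminorm N (\<lambda>z. \<phi> (shear A z))"
      using that by (simp add: Psi_eq[OF A] C test_funs_shear[OF A])
    also have "\<dots> \<le> C * (D * test_seminorm N \<phi>)"
      by (intro mult_left_mono D that C)
    finally show ?thesis by simp
  qed
  then have "\<exists>C N. \<forall>\<phi>\<in>test_funs. cmod (Psi A u \<phi>) \<le> C * test_seminorm N \<phi>"
    by blast
  then show ?thesis
    unfolding distributions_def
    by (auto simp: Psi_eq[OF A] test_funs_add test_funs_cmult test_funs_shear[OF A] distributionsD[OF u])
qed

text \<open>Opposite shears cancel on test functions. Off the test functions both sides vanish by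
  the normalisation of distributions, so equality holds for the functionals as a whole.\<close>

lemma Psi_inverse:
  assumes A: "smooth_circle_fun A" and u: "u \<in> distributions"
  shows "Psi A (Psi (\<lambda>t. - A t) u) = u" "Psi (\<lambda>t. - A t) (Psi A u) = u"
proof -
  have shear: "shear A (shear (\<lambda>t. - A t) z) = z" "shear (\<lambda>t. - A t) (shear A z) = z" for z
    by (simp_all add: shear_def)
  note A' = smooth_circle_fun_minus[OF A]
  have "Psi A (Psi (\<lambda>t. - A t) u) \<phi> = u \<phi> \<and> Psi (\<lambda>t. - A t) (Psi A u) \<phi> = u \<phi>" for \<phi>
    using distributionsD(1)[OF u, of \<phi>]
    by (simp add: Psi_eq[OF A] Psi_eq[OF A'] test_funs_shear[OF A] test_funs_shear[OF A'] shear
        del: split_paired_All)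
  then show "Psi A (Psi (\<lambda>t. - A t) u) = u" "Psi (\<lambda>t. - A t) (Psi A u) = u"
    by blast+
qed

lemma fourier_coeff_eq:
  "fourier_coeff u (\<tau>, \<xi>) = u (tensor_cis (\<lambda>t. cis (- of_int \<tau> * t)) (- \<xi>)) / complex_of_real ((2 * pi)\<^sup>2)"
proof -
  have "(\<lambda>(t, x). exp (- \<i> * complex_of_real (t * of_int \<tau> + x * of_int \<xi>)))
      = tensor_cis (\<lambda>t. cis (- of_int \<tau> * t)) (- \<xi>)"
    by (auto simp: tensor_cis_def fun_eq_iff cis_conv_exp exp_add[symmetric] algebra_simps)
  then show ?thesis by (simp add: fourier_coeff_def)
qed

text \<open>The shear multiplies the mode at frequency \<xi> in \<open>x\<close> by
  \<open>phase A \<xi>\<close>. Expanding the resulting factor in \<open>t\<close> and applying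
  \<open>u\<close> gives the Toeplitz matrix, one \<xi> at a time.\<close>

lemma fourier_coeff_Psi:
  assumes A: "smooth_circle_fun A" and u: "u \<in> distributions"
  shows "(\<lambda>N. \<Sum>\<sigma>\<in>{- int N..int N}. fcoef (phase A \<xi>) (\<sigma> - \<tau>) * fourier_coeff u (\<sigma>, \<xi>))
     \<longlonglongrightarrow> fourier_coeff (Psi A u) (\<tau>, \<xi>)"
proof -
  define h where "h t = phase A \<xi> t * cis (of_int (- \<tau>) * t)" for t
  have h: "smooth_periodic h"
    unfolding h_def by (intro smooth_periodic_mult smooth_periodic_phase A smooth_periodic_cis)
  have cis: "smooth_periodic (\<lambda>t. cis (- of_int \<tau> * t))"
    using smooth_periodic_cis[of "- \<tau>"] by simp
  have "(\<lambda>z. tensor_cis (\<lambda>t. cis (- of_int \<tau> * t)) (- \<xi>) (shear A z)) = tensor_cis h (- \<xi>)"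
    by (auto simp: tensor_cis_def shear_def h_def phase_def fun_eq_iff cis_conv_exp exp_add[symmetric] algebra_simps)
  then have 1: "fourier_coeff (Psi A u) (\<tau>, \<xi>) = u (tensor_cis h (- \<xi>)) / complex_of_real ((2 * pi)\<^sup>2)"
    unfolding fourier_coeff_eq Psi_eq[OF A] using test_funs_tensor_cis[OF cis] by simp
  have coef: "fcoef h \<sigma> = fcoef (phase A \<xi>) (\<sigma> - \<tau>)" for \<sigma>
    unfolding fcoef_def h_def
    by (intro arg_cong[where f = circle_mean] ext) (simp add: cis_mult algebra_simps)
  show ?thesis
    using tendsto_divide[OF distribution_fourier_series[OF u h, of "- \<xi>"] tendsto_const, of "complex_of_real ((2 * pi)\<^sup>2)"]
    unfolding 1 by (simp add: fourier_coeff_eq[of u] coef sum_divide_distrib)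
qed

section \<open>Boundedness on \<open>sobolev s\<close>\<close>

lemma sobolev_term_eq:
  "sobolev_term s u (\<tau>, \<xi>) = bracket2 \<xi> \<tau> powr s * (cmod (fourier_coeff u (\<tau>, \<xi>)))\<^sup>2"
proof -
  have "japanese_bracket (of_int \<tau>, of_int \<xi>) = sqrt (bracket2 \<xi> \<tau>)"
    by (simp add: japanese_bracket_def bracket2_def norm_Pair)
  also have "\<dots> powr (2 * s) = bracket2 \<xi> \<tau> powr s"
    using bracket2_ge_1[of \<xi> \<tau>] by (simp add: powr_half_sqrt[symmetric] powr_powr)
  finally show ?thesis by (simp add: sobolev_term_def)
qed

lemma sobolev_term_nonneg: "sobolev_term s u k \<ge> 0"
  by (cases k) (simp add: sobolev_term_eq)

lemma sobolevD:
  assumes "u \<in> sobolev s"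
  shows "u \<in> distributions" "sobolev_term s u summable_on UNIV"
  using assms by (auto simp: sobolev_def)

text \<open>On a finite box of frequencies the coefficients of \<open>Psi A u\<close> are limits of
  truncated matrix products, each bounded by \<open>C\<close> times the full sum for
  \<open>u\<close>. The box bound passes to the limit, and every finite set of frequencies lies in a
  box. The operator constant is \<open>sqrt C\<close> because the norm is a square root.\<close>

lemma sobolev_Psi:
  assumes A: "smooth_circle_fun A"
  obtains C where "C \<ge> 0"
    "\<And>u. u \<in> sobolev s \<Longrightarrow> Psi A u \<in> sobolev s \<and> sobolev_norm s (Psi A u) \<le> C * sobolev_norm s u"
proof -
  obtain C where C: "C \<ge> 0" "\<And>\<xi>. mat_bound (\<lambda>\<tau>. bracket2 \<xi> \<tau> powr s) (\<lambda>\<tau> \<sigma>. fcoef (phase A \<xi>) (\<sigma> - \<tau>)) C"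
    using mat_bound_phase[OF A] by blast
  have "Psi A u \<in> sobolev s \<and> sobolev_norm s (Psi A u) \<le> sqrt C * sobolev_norm s u"
    if u: "u \<in> sobolev s" for u
  proof -
    let ?S = "infsum (sobolev_term s u) UNIV"
    have box: "(\<Sum>\<xi>\<in>X. \<Sum>\<tau>\<in>T. sobolev_term s (Psi A u) (\<tau>, \<xi>)) \<le> C * ?S"
      if X: "finite X" and T: "finite T" for X T
    proof (rule tendsto_upperbound)
      let ?v = "\<lambda>N \<xi> \<tau>. \<Sum>\<sigma>\<in>{- int N..int N}. fcoef (phase A \<xi>) (\<sigma> - \<tau>) * fourier_coeff u (\<sigma>, \<xi>)"
      show "(\<lambda>N. \<Sum>\<xi>\<in>X. \<Sum>\<tau>\<in>T. bracket2 \<xi> \<tau> powr s * (cmod (?v N \<xi> \<tau>))\<^sup>2)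
          \<longlonglongrightarrow> (\<Sum>\<xi>\<in>X. \<Sum>\<tau>\<in>T. sobolev_term s (Psi A u) (\<tau>, \<xi>))"
        unfolding sobolev_term_eq by (intro tendsto_intros fourier_coeff_Psi A sobolevD(1)[OF u])
      \<comment> \<open>For each \<xi> the truncation is a finite vector, so
        \<open>mat_boundD\<close> applies; the common \<open>C\<close> then factors out of the sum
        over \<open>X\<close>.\<close>
      have "(\<Sum>\<xi>\<in>X. \<Sum>\<tau>\<in>T. bracket2 \<xi> \<tau> powr s * (cmod (?v N \<xi> \<tau>))\<^sup>2) \<le> C * ?S" for N
      proof -
        have "(\<Sum>\<xi>\<in>X. \<Sum>\<tau>\<in>T. bracket2 \<xi> \<tau> powr s * (cmod (?v N \<xi> \<tau>))\<^sup>2)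
            \<le> (\<Sum>\<xi>\<in>X. C * (\<Sum>\<sigma>\<in>{- int N..int N}. bracket2 \<xi> \<sigma> powr s * (cmod (fourier_coeff u (\<sigma>, \<xi>)))\<^sup>2))"
          by (intro sum_mono mat_boundD[OF C(2)] T) simp
        also have "\<dots> = C * (\<Sum>k\<in>{- int N..int N} \<times> X. sobolev_term s u k)"
          unfolding sobolev_term_eq[symmetric] sum_distrib_left[symmetric]
          by (subst sum.swap) (simp add: sum.cartesian_product)
        also have "\<dots> \<le> C * ?S"
          using X by (intro mult_left_mono C finite_sum_le_infsum sobolevD(2)[OF u])
            (auto simp: sobolev_term_nonneg)
        finally show ?thesis .
      qed
      then show "\<forall>\<^sub>F N in sequentially. (\<Sum>\<xi>\<in>X. \<Sum>\<tau>\<in>T. bracket2 \<xi> \<tau> powr s * (cmod (?v N \<xi> \<tau>))\<^sup>2) \<le> C * ?S"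
        by (intro always_eventually allI)
    qed simp
    have fin: "sum (sobolev_term s (Psi A u)) F \<le> C * ?S" if F: "finite F" for F
    proof -
      have "sum (sobolev_term s (Psi A u)) F \<le> sum (sobolev_term s (Psi A u)) (fst ` F \<times> snd ` F)"
        using F by (intro sum_mono2) (auto simp: sobolev_term_nonneg subset_fst_snd)
      also have "\<dots> = (\<Sum>\<xi>\<in>snd ` F. \<Sum>\<tau>\<in>fst ` F. sobolev_term s (Psi A u) (\<tau>, \<xi>))"
        by (subst sum.swap) (simp add: sum.cartesian_product)
      also have "\<dots> \<le> C * ?S"
        using F by (intro box) auto
      finally show ?thesis .
    qed
    have sm: "sobolev_term s (Psi A u) summable_on UNIV"
      using fin by (intro nonneg_bdd_above_summable_on) (auto simp: sobolev_term_nonneg intro!: bdd_aboveI)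
    moreover have "infsum (sobolev_term s (Psi A u)) UNIV \<le> C * ?S"
      by (rule infsum_le_finite_sums[OF sm]) (rule fin)
    then have "sobolev_norm s (Psi A u) \<le> sqrt C * sobolev_norm s u"
      unfolding sobolev_norm_def real_sqrt_mult[symmetric] by simp
    ultimately show ?thesis
      using Psi_distributions[OF A sobolevD(1)[OF u]] by (simp add: sobolev_def)
  qed
  then show ?thesis using that[of "sqrt C"] C by simp
qed

section \<open>Linear structure and invertibility\<close>

lemma distributions_add:
  assumes u: "u \<in> distributions" and v: "v \<in> distributions"
  shows "(\<lambda>\<phi>. u \<phi> + v \<phi>) \<in> distributions"
proof -
  obtain C M where C: "C \<ge> 0" "\<And>\<phi>. \<phi> \<in> test_funs \<Longrightarrow> cmod (u \<phi>) \<le> C * test_seminorm M \<phi>"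
    using distributions_bound[OF u] by blast
  obtain D N where D: "D \<ge> 0" "\<And>\<phi>. \<phi> \<in> test_funs \<Longrightarrow> cmod (v \<phi>) \<le> D * test_seminorm N \<phi>"
    using distributions_bound[OF v] by blast
  have "cmod (u \<phi> + v \<phi>) \<le> (C + D) * test_seminorm (max M N) \<phi>" if \<phi>: "\<phi> \<in> test_funs" for \<phi>
  proof -
    have "cmod (u \<phi> + v \<phi>) \<le> C * test_seminorm M \<phi> + D * test_seminorm N \<phi>"
      by (intro norm_triangle_le add_mono C D \<phi>)
    also have "\<dots> \<le> C * test_seminorm (max M N) \<phi> + D * test_seminorm (max M N) \<phi>"
      by (intro add_mono mult_left_mono test_seminorm_mono \<phi> C D) auto
    finally show ?thesis by (simp add: distrib_right)
  qed
  then have "\<exists>C N. \<forall>\<phi>\<in>test_funs. cmod (u \<phi> + v \<phi>) \<le> C * test_seminorm N \<phi>"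
    by blast
  then show ?thesis
    unfolding distributions_def by (auto simp: distributionsD[OF u] distributionsD[OF v] algebra_simps)
qed

lemma distributions_cmult:
  assumes u: "u \<in> distributions"
  shows "(\<lambda>\<phi>. c * u \<phi>) \<in> distributions"
proof -
  obtain C N where C: "\<And>\<phi>. \<phi> \<in> test_funs \<Longrightarrow> cmod (u \<phi>) \<le> C * test_seminorm N \<phi>"
    using distributions_bound[OF u] by blast
  have "cmod (c * u \<phi>) \<le> (cmod c * C) * test_seminorm N \<phi>" if "\<phi> \<in> test_funs" for \<phi>
    using mult_left_mono[OF C[OF that] norm_ge_zero[of c]] by (simp add: norm_mult mult.assoc)
  then have "\<exists>C N. \<forall>\<phi>\<in>test_funs. cmod (c * u \<phi>) \<le> C * test_seminorm N \<phi>"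
    by blast
  then show ?thesis
    unfolding distributions_def by (auto simp: distributionsD[OF u] algebra_simps)
qed

lemma sobolev_add:
  assumes u: "u \<in> sobolev s" and v: "v \<in> sobolev s"
  shows "(\<lambda>\<phi>. u \<phi> + v \<phi>) \<in> sobolev s"
proof -
  have le: "sobolev_term s (\<lambda>\<phi>. u \<phi> + v \<phi>) k \<le> 2 * sobolev_term s u k + 2 * sobolev_term s v k" for k
  proof -
    obtain \<tau> \<xi> where k: "k = (\<tau>, \<xi>)" by (cases k)
    have "fourier_coeff (\<lambda>\<phi>. u \<phi> + v \<phi>) k = fourier_coeff u k + fourier_coeff v k"
      by (simp add: k fourier_coeff_def add_divide_distrib)
    then show ?thesis
      using mult_left_mono[OF cmod_add_power2_le[of "fourier_coeff u k" "fourier_coeff v k"], of "bracket2 \<xi> \<tau> powr s"]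
      by (simp add: k sobolev_term_eq algebra_simps)
  qed
  have "(\<lambda>k. 2 * sobolev_term s u k + 2 * sobolev_term s v k) summable_on UNIV"
    by (intro summable_on_add summable_on_cmult_right sobolevD u v)
  then have "sobolev_term s (\<lambda>\<phi>. u \<phi> + v \<phi>) summable_on UNIV"
    by (rule summable_on_comparison_test) (rule le, rule sobolev_term_nonneg)
  then show ?thesis using distributions_add[of u v] sobolevD(1)[OF u] sobolevD(1)[OF v] by (simp add: sobolev_def)
qed

lemma sobolev_cmult:
  assumes u: "u \<in> sobolev s"
  shows "(\<lambda>\<phi>. c * u \<phi>) \<in> sobolev s"
proof -
  have "sobolev_term s (\<lambda>\<phi>. c * u \<phi>) k = (cmod c)\<^sup>2 * sobolev_term s u k" for k
    by (cases k) (simp add: sobolev_term_def fourier_coeff_def norm_mult norm_divide power_mult_distrib power_divide)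
  then have "sobolev_term s (\<lambda>\<phi>. c * u \<phi>) = (\<lambda>k. (cmod c)\<^sup>2 * sobolev_term s u k)" ..
  then have "sobolev_term s (\<lambda>\<phi>. c * u \<phi>) summable_on UNIV"
    by (simp only: summable_on_cmult_right[OF sobolevD(2)[OF u]])
  then show ?thesis using distributions_cmult sobolevD(1)[OF u] by (simp add: sobolev_def)
qed

lemma bounded_operator_sobolev_Psi:
  assumes A: "smooth_circle_fun A"
  shows "bounded_operator_sobolev s (Psi A)"
proof -
  obtain C where C: "\<And>u. u \<in> sobolev s \<Longrightarrow> Psi A u \<in> sobolev s \<and> sobolev_norm s (Psi A u) \<le> C * sobolev_norm s u"
    using sobolev_Psi[OF A] by blast
  have "Psi A (\<lambda>\<phi>. u \<phi> + v \<phi>) = (\<lambda>\<phi>. Psi A u \<phi> + Psi A v \<phi>)"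
    "Psi A (\<lambda>\<phi>. c * u \<phi>) = (\<lambda>\<phi>. c * Psi A u \<phi>)" for u v c
    unfolding Psi_eq[OF A] by auto
  with C show ?thesis
    unfolding bounded_operator_sobolev_def by blast
qed

text \<open>\<open>inv_into\<close> is identified with \<open>Psi (\<lambda>t. - A t)\<close> on
  \<open>sobolev s\<close> only. Its linearity clauses evaluate it at sums and multiples, which must
  therefore be known to stay in the space.\<close>

lemma bounded_operator_sobolev_cong:
  assumes "bounded_operator_sobolev s T" "\<And>u. u \<in> sobolev s \<Longrightarrow> T' u = T u"
  shows "bounded_operator_sobolev s T'"
  using assms unfolding bounded_operator_sobolev_def by (simp add: sobolev_add sobolev_cmult Pi_iff)

lemma bounded_automorphism_sobolev_Psi:
  assumes A: "smooth_circle_fun A"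
  shows "bounded_automorphism_sobolev s (Psi A)"
proof -
  note A' = smooth_circle_fun_minus[OF A]
  note inv = Psi_inverse[OF A sobolevD(1)]
  have maps: "Psi A u \<in> sobolev s" "Psi (\<lambda>t. - A t) u \<in> sobolev s" if "u \<in> sobolev s" for u
    using that bounded_operator_sobolev_Psi[OF A, of s] bounded_operator_sobolev_Psi[OF A', of s]
    by (auto simp: bounded_operator_sobolev_def Pi_iff)
  have bij: "bij_betw (Psi A) (sobolev s) (sobolev s)"
    by (rule bij_betw_byWitness[of _ "Psi (\<lambda>t. - A t)"]) (auto simp: inv maps)
  have "inv_into (sobolev s) (Psi A) u = Psi (\<lambda>t. - A t) u" if "u \<in> sobolev s" for u
    using that bij by (intro inv_into_f_eq) (auto simp: inv maps bij_betw_def)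
  then show ?thesis
    unfolding bounded_automorphism_sobolev_def
    using bounded_operator_sobolev_cong[OF bounded_operator_sobolev_Psi[OF A']]
      bounded_operator_sobolev_Psi[OF A] bij by blast
qed

theorem proposition6p7:
  fixes A :: "real \<Rightarrow> real" and s :: real
  assumes "smooth_circle_fun A"
  shows "bounded_automorphism_sobolev s (Psi A) \<and>
         bounded_automorphism_sobolev s (Psi (\<lambda>t. - A t)) \<and>
         (\<forall>u\<in>sobolev s. Psi A (Psi (\<lambda>t. - A t) u) = u \<and> Psi (\<lambda>t. - A t) (Psi A u) = u)"
  using assms
  by (simp add: bounded_automorphism_sobolev_Psi smooth_circle_fun_minus Psi_inverse sobolevD)

end
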